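(* Let $J=J_{a,b}$ be a $p$-periodic Jacobi matrix with integrated density of states $k$. There is a constant $C>0$ depending only on $\|a\|_\infty$ such that for every $E\in\mathbb{R}$ with $D(E)\in(-2,2)$, $$\frac{dk}{dE}(E)\ \ge\ \frac{C}{p}\sum_{j=1}^p\|M_j\|_2^2,$$ where $\|M\|_2=\sqrt{\mathrm{Tr}(M^*M)}$ is the Hilbert–Schmidt norm. If $a$ is a constant sequence $a_n\equiv a_0$, then equality holds with $C=\frac{1}{2(1+a_0^2)\pi}$.
   Context: $J_{a,b}$ acts on $\ell^2(\mathbb{Z})$ by $[Ju]_n=a_{n-1}u_{n-1}+b_nu_n+a_nu_{n+1}$ with $a_n>0$, $b_n\in\mathbb{R}$, $a_{n+p}=a_n$, $b_{n+p}=b_n$. The density of states measure $dk$ is defined by $\int f\,dk=\frac1p\sum_{n=0}^{p-1}\langle\delta_n,f(J)\delta_n\rangle$ and the integrated density of states is $k(E)=dk((-\infty,E])$. For energy $E$ let $T_j=\frac{1}{a_j}\begin{pmatrix}E-b_j & -1\\ a_j^2 & 0\end{pmatrix}$, $A_0=I$, $A_j=T_j\cdots T_1$ for $j\ge1$, and $\Phi_j=A_{j-1}A_pA_{j-1}^{-1}$; the discriminant is $D(E)=\mathrm{Tr}\,A_p$. When $D(E)\in(-2,2)$, each $\Phi_j\in\mathrm{SL}(2,\mathbb{R})$ has trace in $(-2,2)$ and $M_j\in\mathrm{SL}(2,\mathbb{R})$ denotes any matrix with $M_j\Phi_jM_j^{-1}\in\mathrm{SO}(2,\mathbb{R})$;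 such $M_j$ is unique up to left multiplication by an element of $\mathrm{SO}(2,\mathbb{R})$, so $\|M_j\|_2$ is well defined. *)

theory Defs
  imports "HOL-Analysis.Analysis" "HOL-Probability.Probability"
begin

text \<open>Jacobi matrix entries on l2(Z): [J u]_m = a(m-1) u(m-1) + b m u m + a m u(m+1),
  so the (m,n) matrix entry is the coefficient of u n in [J u]_m.\<close>
definition jac_entry :: "(int \<Rightarrow> real) \<Rightarrow> (int \<Rightarrow> real) \<Rightarrow> int \<Rightarrow> int \<Rightarrow> real" where
  "jac_entry a b m n =
     (if n = m - 1 then a (m - 1) else if n = m then b m else if n = m + 1 then a m else 0)"

text \<open>Matrix entries of the powers J^k (each row of J has finite support).\<close>
fun jac_pow :: "(int \<Rightarrow> real) \<Rightarrow> (int \<Rightarrow> real) \<Rightarrow> nat \<Rightarrow> int \<Rightarrow> int \<Rightarrow> real" where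
  "jac_pow a b 0 m n = (if m = n then 1 else 0)"
| "jac_pow a b (Suc k) m n = (\<Sum>l\<in>{n - 1..n + 1}. jac_pow a b k m l * jac_entry a b l n)"

text \<open>Density of states measure dk: the (unique) compactly supported finite Borel measure with
  \<integral> f dk = (1/p) \<Sum>_{n<p} <delta_n, f(J) delta_n> for all polynomials f, i.e. for all monomials x^k.
  For bounded self-adjoint J this determines the measure defined via continuous functional calculus.\<close>
definition dos_measure :: "nat \<Rightarrow> (int \<Rightarrow> real) \<Rightarrow> (int \<Rightarrow> real) \<Rightarrow> real measure" where
  "dos_measure p a b = (THE \<mu>. sets \<mu> = sets borel \<and> finite_measure \<mu> \<and>
      (\<exists>R. emeasure \<mu> {x. R < \<bar>x\<bar>} = 0) \<and>
      (\<forall>k. integral\<^sup>L \<mu> (\<lambda>x. x ^ k) = (1 / real p) * (\<Sum>n<p. jac_pow a b k (int n) (int n))))"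

definition ids :: "nat \<Rightarrow> (int \<Rightarrow> real) \<Rightarrow> (int \<Rightarrow> real) \<Rightarrow> real \<Rightarrow> real" where
  "ids p a b E = measure (dos_measure p a b) {..E}"

definition mat2 :: "real \<Rightarrow> real \<Rightarrow> real \<Rightarrow> real \<Rightarrow> real^2^2" where
  "mat2 x y z w = (\<chi> i j. if i = 1 then (if j = 1 then x else y) else (if j = 1 then z else w))"

definition transfer :: "(int \<Rightarrow> real) \<Rightarrow> (int \<Rightarrow> real) \<Rightarrow> real \<Rightarrow> nat \<Rightarrow> real^2^2" where
  "transfer a b E j = (1 / a (int j)) *\<^sub>R mat2 (E - b (int j)) (-1) ((a (int j))\<^sup>2) 0"

fun Amat :: "(int \<Rightarrow> real) \<Rightarrow> (int \<Rightarrow> real) \<Rightarrow> real \<Rightarrow> nat \<Rightarrow> real^2^2" where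
  "Amat a b E 0 = mat 1"
| "Amat a b E (Suc j) = transfer a b E (Suc j) ** Amat a b E j"

definition discr :: "nat \<Rightarrow> (int \<Rightarrow> real) \<Rightarrow> (int \<Rightarrow> real) \<Rightarrow> real \<Rightarrow> real" where
  "discr p a b E = trace (Amat a b E p)"

text \<open>Phi_j = A_{j-1} A_p A_{j-1}^{-1} (used for j = 1..p).\<close>
definition Phi :: "nat \<Rightarrow> (int \<Rightarrow> real) \<Rightarrow> (int \<Rightarrow> real) \<Rightarrow> real \<Rightarrow> nat \<Rightarrow> real^2^2" where
  "Phi p a b E j = Amat a b E (j - 1) ** Amat a b E p ** matrix_inv (Amat a b E (j - 1))"

definition in_SO2 :: "real^2^2 \<Rightarrow> bool" where
  "in_SO2 R \<longleftrightarrow> transpose R ** R = mat 1 \<and> det R = 1"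

definition conj_to_SO2 :: "real^2^2 \<Rightarrow> real^2^2 \<Rightarrow> bool" where
  "conj_to_SO2 M Ph \<longleftrightarrow> det M = 1 \<and> in_SO2 (M ** Ph ** matrix_inv M)"

definition hs_norm_sq :: "real^2^2 \<Rightarrow> real" where
  "hs_norm_sq M = trace (transpose M ** M)"

definition periodic_jacobi :: "nat \<Rightarrow> (int \<Rightarrow> real) \<Rightarrow> (int \<Rightarrow> real) \<Rightarrow> bool" where
  "periodic_jacobi p a b \<longleftrightarrow> p \<ge> 1 \<and> (\<forall>n. a n > 0) \<and>
     (\<forall>n. a (n + int p) = a n) \<and> (\<forall>n. b (n + int p) = b n)"

definition sup_norm :: "(int \<Rightarrow> real) \<Rightarrow> real" where
  "sup_norm a = (SUP n. \<bar>a n\<bar>)"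

end

theory Submission
  imports Defs "HOL-Computational_Algebra.Fundamental_Theorem_Algebra"
begin

text \<open>
  For real phi, the quasi-periodic solutions u(n+p) = exp(i phi) u(n) of J u = E u exist exactly when
  D(E) = 2 cos phi. A Wronskian argument makes such energies real and the solutions orthogonal over a
  period; as D' is nonzero wherever |D| < 2, there are exactly p of them, so the solutions form an
  orthonormal basis and the sum of E^k over the roots of D = 2 cos phi is a trigonometric polynomial
  in phi whose mean is the trace of J^k over one period. Hence dk is the push-forward of
  d(phi)/(pi p) on (0,pi) under the p inverse branches of D = 2 cos phi, and
  dk/dE = |D'| / (2 pi p sqrt(1 - D^2/4)).
  On the other side, D' = - sum (Phi_j)_12. With Phi_j conjugate by M_j to a rotation by an angle with sine s,
  (Phi_j)_12 = - s |M_j e2|^2 and (Phi_j)_21 = s |M_j e1|^2, while (Phi_{j+1})_21 = - a_j^2 (Phi_j)_12,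
  so sum |M_j|^2 is sum (1 + a_j^2) |(Phi_j)_12| / sqrt(1 - D^2/4).
\<close>

section \<open>Compactly supported measures are determined by their moments\<close>

text \<open>\<open>dos_measure\<close> is a definite description, so existence and uniqueness of the
  measure are both owed before anything can be said about \<open>ids\<close>. Uniqueness comes from
  the moments, existence from an explicit measure; spectral theory on l2 is never entered, since
  only matrix entries of powers of J occur. The zeros of D serve as names of the p bands. Bands may
  touch where a gap is closed, hence roots are counted only where |D| < 2, and the endpoints of (0,
  pi) are dropped as a null set. What makes D' nonzero there is that all (Phi_j)_12 carry the same
  sign, by determinant, trace and the recursion from j to j+1; so |D'| is the sum of the
  |(Phi_j)_12|. Whether D rises or falls on a band is not tracked: an inverse branch yields dk/dE up
  to sign, and monotonicity of k settles the sign. The two sums over j differ only in the weights 1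
  + a_j^2, which are at most 1 + ||a||^2 and constant if a is; this is the origin of C = 1/(2 pi (1
  + ||a||^2)), where 2 pi combines the density 1/pi in phi with the derivative of
  arccos(D/2).\<close>

lemma integrable_continuous_compact_support:
  fixes f :: "real \<Rightarrow> real"
  assumes "sets \<mu> = sets borel" "finite_measure \<mu>" "emeasure \<mu> {x. R < \<bar>x\<bar>} = 0"
    and "continuous_on UNIV f"
  shows "integrable \<mu> f" "AE x in \<mu>. x \<in> {-R..R}"
proof -
  interpret finite_measure \<mu> by fact
  have "{x. R < \<bar>x\<bar>} \<in> null_sets \<mu>"
    using assms by (auto simp: null_sets_def)
  then show ae: "AE x in \<mu>. x \<in> {-R..R}"
    by (rule AE_I') auto
  have "bounded (f ` {-R..R})"
    using assms(4) by (intro compact_imp_bounded compact_continuous_image) (auto intro: continuous_on_subset)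
  then obtain B where "\<forall>y\<in>f ` {-R..R}. norm y \<le> B"
    unfolding bounded_iff by blast
  then have B: "\<And>x. x \<in> {-R..R} \<Longrightarrow> norm (f x) \<le> B" by blast
  have "f \<in> borel_measurable \<mu>"
    using borel_measurable_continuous_onI[OF assms(4)] assms(1) by (simp cong: measurable_cong_sets)
  moreover have "AE x in \<mu>. norm (f x) \<le> B"
    using ae by eventually_elim (rule B)
  ultimately show "integrable \<mu> f"
    by (intro integrable_const_bound[where B = B])
qed

text \<open>Weierstrass approximation on \<open>{-R..R}\<close>, which carries both measures:
  polynomials have equal integrals by the moments, and the error is the uniform distance times the
  total masses.\<close>

lemma continuous_integral_eq_of_moments_eq:
  fixes f :: "real \<Rightarrow> real"
  assumes \<mu>: "sets \<mu> = sets borel" "finite_measure \<mu>" "emeasure \<mu> {x. R < \<bar>x\<bar>} = 0"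
    and \<nu>: "sets \<nu> = sets borel" "finite_measure \<nu>" "emeasure \<nu> {x. R < \<bar>x\<bar>} = 0"
    and moments: "\<And>k. integral\<^sup>L \<mu> (\<lambda>x. x ^ k) = integral\<^sup>L \<nu> (\<lambda>x. x ^ k)"
    and f: "continuous_on UNIV f"
  shows "integral\<^sup>L \<mu> f = integral\<^sup>L \<nu> f"
proof -
  \<comment> \<open>The summand 1 keeps \<open>c\<close> positive even if both masses vanish, so
    that \<open>e / c\<close> is a legitimate tolerance.\<close>
  define c where "c = measure \<mu> UNIV + measure \<nu> UNIV + 1"
  have c: "c > 0" by (auto simp: c_def intro: add_nonneg_pos)
  have "\<bar>integral\<^sup>L \<mu> f - integral\<^sup>L \<nu> f\<bar> \<le> e" if "e > 0" for e
  proof -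
    have "continuous_on {-R..R} f" "e / c > 0"
      using f continuous_on_subset c that by auto
    from Stone_Weierstrass_real_polynomial_function[OF compact_Icc this]
    obtain g where g: "real_polynomial_function g" "\<And>x. x \<in> {-R..R} \<Longrightarrow> \<bar>f x - g x\<bar> < e / c"
      by blast
    obtain a n where an: "g = (\<lambda>x. \<Sum>i\<le>n. a i * x ^ i)"
      using g(1) by (auto simp: real_polynomial_function_iff_sum)
    have cg: "continuous_on UNIV g"
      unfolding an by (intro continuous_intros)
    have lin: "integral\<^sup>L m g = (\<Sum>i\<le>n. a i * integral\<^sup>L m (\<lambda>x. x ^ i))"
      if "sets m = sets borel" "finite_measure m" "emeasure m {x. R < \<bar>x\<bar>} = 0" for m
      unfolding an
      by (subst Bochner_Integration.integral_sum)
         (auto intro!: integrable_continuous_compact_support(1)[OF that] continuous_intros)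
    have gg: "integral\<^sup>L \<mu> g = integral\<^sup>L \<nu> g"
      using lin[OF \<mu>] lin[OF \<nu>] moments by simp
    have close: "\<bar>integral\<^sup>L m f - integral\<^sup>L m g\<bar> \<le> e / c * measure m UNIV"
      if m: "sets m = sets borel" "finite_measure m" "emeasure m {x. R < \<bar>x\<bar>} = 0" for m
    proof -
      interpret finite_measure m by fact
      have sp: "space m = UNIV" using sets_eq_imp_space_eq[OF m(1)] by simp
      note i = integrable_continuous_compact_support[OF m]
      have "\<bar>integral\<^sup>L m f - integral\<^sup>L m g\<bar> = \<bar>integral\<^sup>L m (\<lambda>x. f x - g x)\<bar>"
        using i(1)[OF f] i(1)[OF cg] by simp
      also have "\<dots> \<le> integral\<^sup>L m (\<lambda>x. \<bar>f x - g x\<bar>)"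
        by (rule integral_abs_bound)
      also have "\<dots> \<le> integral\<^sup>L m (\<lambda>x. e / c)"
      proof (intro integral_mono_AE)
        show "AE x in m. \<bar>f x - g x\<bar> \<le> e / c"
          using i(2)[OF f] by eventually_elim (rule less_imp_le[OF g(2)])
      qed (use i(1)[OF f] i(1)[OF cg] in simp_all)
      finally show ?thesis by (simp add: sp mult.commute)
    qed
    have "\<bar>integral\<^sup>L \<mu> f - integral\<^sup>L \<nu> f\<bar> \<le> e / c * measure \<mu> UNIV + e / c * measure \<nu> UNIV"
      using close[OF \<mu>] close[OF \<nu>] gg by linarith
    also have "\<dots> = e / c * (measure \<mu> UNIV + measure \<nu> UNIV)" by (simp add: algebra_simps)
    also have "\<dots> \<le> e / c * c"
      using that c by (intro mult_left_mono) (auto simp: c_def)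
    finally show ?thesis using c by simp
  qed
  then show ?thesis
    by (metis abs_ge_zero abs_le_zero_iff dense_ge eq_iff_diff_eq_0)
qed

text \<open>Distribution functions are compared through continuous ramps:
  \<open>cts_step x y\<close> lies between the indicators of \<open>{..x}\<close> and
  \<open>{..y}\<close>, so each distribution function at x is at most the other at any y > x, and
  right continuity lets y decrease to x.\<close>

lemma measure_eq_of_moments_eq:
  fixes \<mu> \<nu> :: "real measure"
  assumes \<mu>: "sets \<mu> = sets borel" "finite_measure \<mu>" "emeasure \<mu> {x. R < \<bar>x\<bar>} = 0"
    and \<nu>: "sets \<nu> = sets borel" "finite_measure \<nu>" "emeasure \<nu> {x. S < \<bar>x\<bar>} = 0"
    and moments: "\<And>k. integral\<^sup>L \<mu> (\<lambda>x. x ^ k) = integral\<^sup>L \<nu> (\<lambda>x. x ^ k)"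
  shows "\<mu> = \<nu>"
proof -
  define T where "T = max R S"
  have sub: "{x. T < \<bar>x\<bar>} \<subseteq> {x::real. R < \<bar>x\<bar>}" "{x. T < \<bar>x\<bar>} \<subseteq> {x::real. S < \<bar>x\<bar>}"
    by (auto simp: T_def)
  have \<mu>': "emeasure \<mu> {x. T < \<bar>x\<bar>} = 0"
    using emeasure_mono[OF sub(1), of \<mu>] \<mu> by (auto simp: \<mu>(1))
  have \<nu>': "emeasure \<nu> {x. T < \<bar>x\<bar>} = 0"
    using emeasure_mono[OF sub(2), of \<nu>] \<nu> by (auto simp: \<nu>(1))
  have cts: "continuous_on UNIV (cts_step x y)" if "x < y" for x y
    using uniformly_continuous_imp_continuous[OF cts_step_uniformly_continuous[OF that]] .
  note eq = continuous_integral_eq_of_moments_eq[OF \<mu>(1,2) \<mu>' \<nu>(1,2) \<nu>' moments]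
  have bounds: "measure m {..x} \<le> integral\<^sup>L m (cts_step x y) \<and>
      integral\<^sup>L m (cts_step x y) \<le> measure m {..y}"
    if m: "sets m = sets borel" "finite_measure m" "emeasure m {x. T < \<bar>x\<bar>} = 0" and "x < y" for m x y
  proof -
    interpret finite_measure m by fact
    have sp: "space m = UNIV" using sets_eq_imp_space_eq[OF m(1)] by simp
    have i: "integrable m (cts_step x y)"
      by (rule integrable_continuous_compact_support(1)[OF m cts[OF \<open>x < y\<close>]])
    have s: "{..x} \<in> sets m" "{..y} \<in> sets m" using m(1) by auto
    have j: "integrable m (indicator {..x} :: real \<Rightarrow> real)" "integrable m (indicator {..y} :: real \<Rightarrow> real)"
      using s by (auto intro!: integrable_real_indicator simp: less_top[symmetric])
    have "integral\<^sup>L m (indicator {..x} :: real \<Rightarrow> real) \<le> integral\<^sup>L m (cts_step x y)"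
      using \<open>x < y\<close> by (intro integral_mono i j) (auto simp: cts_step_def split: split_indicator)
    moreover have "integral\<^sup>L m (cts_step x y) \<le> integral\<^sup>L m (indicator {..y} :: real \<Rightarrow> real)"
      using \<open>x < y\<close> by (intro integral_mono i j) (auto simp: cts_step_def split: split_indicator)
    ultimately show ?thesis by (simp add: sp)
  qed
  interpret M: finite_measure \<mu> by fact
  interpret N: finite_measure \<nu> by fact
  have fb: "finite_borel_measure \<mu>" "finite_borel_measure \<nu>"
    using \<mu>(1) \<nu>(1) by unfold_locales
  have lim: "((\<lambda>y. measure m {..y}) \<longlongrightarrow> measure m {..x}) (at_right x)"
    if "finite_borel_measure m" for m :: "real measure" and x
    using finite_borel_measure.cdf_is_right_cont[OF that, of x]
    by (simp add: continuous_within cdf_def)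
  have ev: "eventually (\<lambda>y. x < y) (at_right x)" for x :: real
    by (simp add: eventually_at_filter)
  have le: "measure \<mu> {..x} \<le> measure \<nu> {..y}" "measure \<nu> {..x} \<le> measure \<mu> {..y}" if "x < y" for x y
    using bounds[OF \<mu>(1,2) \<mu>' that] bounds[OF \<nu>(1,2) \<nu>' that] eq[OF cts[OF that]]
    by linarith+
  have cdf: "measure \<mu> {..x} = measure \<nu> {..x}" for x
  proof (rule antisym)
    show "measure \<mu> {..x} \<le> measure \<nu> {..x}"
      by (rule tendsto_lowerbound[OF lim[OF fb(2)] eventually_mono[OF ev]])
         (use le(1) in simp_all)
    show "measure \<nu> {..x} \<le> measure \<mu> {..x}"
      by (rule tendsto_lowerbound[OF lim[OF fb(1)] eventually_mono[OF ev]])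
         (use le(2) in simp_all)
  qed
  \<comment> \<open>The moment of order 0 is the total mass; it turns equality on the half-lines
    \<open>{..x}\<close> into equality on \<open>{x<..}\<close>.\<close>
  have tot: "measure \<mu> UNIV = measure \<nu> UNIV"
    using moments[of 0] sets_eq_imp_space_eq[OF \<mu>(1)] sets_eq_imp_space_eq[OF \<nu>(1)] by simp
  show ?thesis
  proof (rule measure_eqI_lessThan[OF \<mu>(1) \<nu>(1)])
    show "emeasure \<mu> {x<..} < \<infinity>" for x by (simp add: less_top[symmetric])
    have "measure m {x<..} = measure m UNIV - measure m {..x}"
      if "sets m = sets borel" "finite_measure m" for m and x :: real
    proof -
      interpret finite_measure m by fact
      have "space m = UNIV" using sets_eq_imp_space_eq[OF that(1)] by simp
      moreover have "UNIV - {..x} = {x<..}" by (simp add: set_eq_iff not_le)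
      ultimately show ?thesis using finite_measure_compl[of "{..x}"] that(1) by simp
    qed
    then have "measure \<mu> {x<..} = measure \<nu> {x<..}" for x
      using \<mu>(1,2) \<nu>(1,2) tot cdf by simp
    then show "emeasure \<mu> {x<..} = emeasure \<nu> {x<..}" for x
      by (simp only: M.emeasure_eq_measure N.emeasure_eq_measure)
  qed
qed

text \<open>Bessel's inequality for the unit vectors, summed over them, is an equality by counting.\<close>
lemma complex_orthonormal_imp_complete:
  fixes u :: "'b \<Rightarrow> 'a \<Rightarrow> complex"
  assumes fin: "finite I" "finite X" and card: "card X = card I"
    and on: "\<And>x y. x \<in> X \<Longrightarrow> y \<in> X \<Longrightarrow> (\<Sum>n\<in>I. u x n * cnj (u y n)) = (if x = y then 1 else 0)"
    and mn: "m \<in> I" "n \<in> I"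
  shows "(\<Sum>x\<in>X. cnj (u x m) * u x n) = (if m = n then 1 else 0)"
proof -
  define K where "K m n = (\<Sum>x\<in>X. cnj (u x m) * u x n)" for m n
  define d where "d m n = (if m = n then 1 else 0 :: complex)" for m n :: 'a
  have proj: "(\<Sum>n\<in>I. K m n * cnj (K m n)) = K m m" for m
  proof -
    have "(\<Sum>n\<in>I. K m n * cnj (K m n)) = (\<Sum>n\<in>I. \<Sum>x\<in>X. \<Sum>y\<in>X. cnj (u x m) * u y m * (u x n * cnj (u y n)))"
      unfolding K_def cnj_sum sum_product by (intro sum.cong refl) simp
    also have "\<dots> = (\<Sum>x\<in>X. \<Sum>y\<in>X. \<Sum>n\<in>I. cnj (u x m) * u y m * (u x n * cnj (u y n)))"
      by (subst sum.swap, rule sum.cong[OF refl], subst sum.swap, rule refl)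
    also have "\<dots> = (\<Sum>x\<in>X. \<Sum>y\<in>X. cnj (u x m) * u y m * (if x = y then 1 else 0))"
      by (intro sum.cong refl) (simp only: sum_distrib_left[symmetric] on)
    also have "\<dots> = K m m"
      using fin by (simp add: K_def if_distrib cong: if_cong)
    finally show ?thesis .
  qed
  \<comment> \<open>Row m of \<open>K\<close> is the projection of the unit vector
    \<open>d m\<close> onto the span of the \<open>u x\<close>, and this is its squared distance
    from \<open>d m\<close>. Summed over m the distances give card I - card X = 0, so each of them
    vanishes.\<close>
  have dist: "(\<Sum>n\<in>I. (d m n - K m n) * cnj (d m n - K m n)) = 1 - K m m" if "m \<in> I" for m
  proof -
    have "cnj (K m m) = K m m" by (simp add: K_def cnj_sum mult.commute)
    moreover have "(\<Sum>n\<in>I. d m n * x n) = x m" for x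
      using that fin by (simp add: d_def if_distrib[where f = "\<lambda>y. y * _"] cong: if_cong)
    moreover have "(d m n - K m n) * cnj (d m n - K m n)
        = d m n * (1 - cnj (K m n)) - d m n * K m n + K m n * cnj (K m n)" for n
      by (simp add: d_def algebra_simps)
    ultimately show ?thesis
      by (simp add: sum.distrib sum_subtractf proj)
  qed
  have "(\<Sum>m\<in>I. K m m) = (\<Sum>x\<in>X. \<Sum>m\<in>I. u x m * cnj (u x m))"
    unfolding K_def by (subst sum.swap) (simp add: mult.commute)
  also have "\<dots> = of_nat (card I)" using on card by simp
  finally have "(\<Sum>m\<in>I. \<Sum>n\<in>I. (d m n - K m n) * cnj (d m n - K m n)) = 0"
    using dist by (simp add: sum_subtractf)
  then have "complex_of_real (\<Sum>m\<in>I. \<Sum>n\<in>I. (norm (d m n - K m n))\<^sup>2) = 0"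
    by (simp only: complex_norm_square of_real_sum)
  then have "(\<Sum>m\<in>I. \<Sum>n\<in>I. (norm (d m n - K m n))\<^sup>2) = 0"
    using of_real_eq_0_iff by blast
  then have "(norm (d m n - K m n))\<^sup>2 = 0"
    using fin mn by (simp add: sum_nonneg_eq_0_iff sum_nonneg)
  then show ?thesis by (simp add: K_def d_def)
qed

section \<open>Transfer matrices and the derivative of the discriminant\<close>

text \<open>\<open>orbit\<close> is \<open>Amat\<close> applied to a vector, over an arbitrary field so that complex energies are allowed;
  it takes (u 1, a 0 u 0) to (u (n+1), a n u n).\<close>
fun orbit :: "(int \<Rightarrow> real) \<Rightarrow> (int \<Rightarrow> real) \<Rightarrow> 'a::real_field \<Rightarrow> 'a \<times> 'a \<Rightarrow> nat \<Rightarrow> 'a \<times> 'a" where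
  "orbit a b E v 0 = v"
| "orbit a b E v (Suc n) =
    (((E - of_real (b (int (Suc n)))) * fst (orbit a b E v n) - snd (orbit a b E v n)) / of_real (a (int (Suc n))),
     of_real (a (int (Suc n))) * fst (orbit a b E v n))"

section \<open>Two by two matrices and conjugation to a rotation\<close>

lemma mat2_nth [simp]:
  "mat2 x y z w $ 1 $ 1 = x" "mat2 x y z w $ 1 $ 2 = y" "mat2 x y z w $ 2 $ 1 = z" "mat2 x y z w $ 2 $ 2 = w"
  by (simp_all add: mat2_def)

lemma matrix_mult_2: "((A :: real^2^2) ** B) $ i $ j = A $ i $ 1 * B $ 1 $ j + A $ i $ 2 * B $ 2 $ j"
  by (simp add: matrix_matrix_mult_def sum_2)

lemma trace_2: "trace (A :: real^2^2) = A $ 1 $ 1 + A $ 2 $ 2"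
  by (simp add: trace_def sum_2)

lemma mat_2_eq_iff: "A = B \<longleftrightarrow> A $ 1 $ 1 = B $ 1 $ 1 \<and> A $ 1 $ 2 = B $ 1 $ 2 \<and> A $ 2 $ 1 = B $ 2 $ 1 \<and> A $ 2 $ 2 = B $ 2 $ 2"
  for A B :: "real^2^2"
  by (auto simp: vec_eq_iff forall_2)

lemma matrix_mul_sum_right: "(A :: real^2^2) ** (\<Sum>i\<in>I. f i) = (\<Sum>i\<in>I. A ** f i)"
proof -
  have "A ** 0 = 0" by (simp add: mat_2_eq_iff matrix_mult_2)
  then show ?thesis
    by (induction I rule: infinite_finite_induct) (simp_all add: matrix_add_ldistrib)
qed

lemma matrix_inv_of_det_1:
  fixes A :: "real^2^2"
  assumes "det A = 1"
  shows "A ** matrix_inv A = mat 1" "matrix_inv A ** A = mat 1"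
proof -
  have "invertible A" using assms by (simp add: invertible_det_nz)
  then show "A ** matrix_inv A = mat 1" "matrix_inv A ** A = mat 1"
    unfolding matrix_inv_def invertible_def by (metis (mono_tags, lifting) someI_ex)+
qed

lemma hs_norm_sq_2: "hs_norm_sq M = (M $ 1 $ 1)\<^sup>2 + (M $ 1 $ 2)\<^sup>2 + (M $ 2 $ 1)\<^sup>2 + (M $ 2 $ 2)\<^sup>2"
  by (simp add: hs_norm_sq_def trace_2 matrix_mult_2 transpose_def power2_eq_square)

lemma in_SO2_entries:
  assumes "in_SO2 R"
  shows "R $ 2 $ 2 = R $ 1 $ 1" "R $ 1 $ 2 = - R $ 2 $ 1" "(R $ 1 $ 1)\<^sup>2 + (R $ 2 $ 1)\<^sup>2 = 1"
proof -
  define x y z w where "x = R $ 1 $ 1" "y = R $ 1 $ 2" "z = R $ 2 $ 1" "w = R $ 2 $ 2"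
  have "transpose R ** R = mat 1" "det R = 1" using assms by (auto simp: in_SO2_def)
  then have eq: "x * x + z * z = 1" "x * y + z * w = 0" "y * y + w * w = 1" "x * w - y * z = 1"
    by (auto simp: mat_2_eq_iff matrix_mult_2 transpose_def det_2 mat_def x_y_z_w_def)
  \<comment> \<open>Inserting the factor \<open>x * x + z * z\<close>, which is 1, solves the linear
    equations for \<open>w\<close>, and below for \<open>y\<close>, without division.\<close>
  have "w = (x * x + z * z) * w" using eq by simp
  also have "\<dots> = x * (x * w - y * z) + z * (x * y + z * w)" by algebra
  finally have w: "w = x" using eq by simp
  have "y = (x * x + z * z) * y" using eq by simp
  also have "\<dots> = x * (x * y + z * w) - z * (x * w - y * z)" by algebra
  finally have "y = - z" using eq by simp
  then show "R $ 2 $ 2 = R $ 1 $ 1" "R $ 1 $ 2 = - R $ 2 $ 1" "(R $ 1 $ 1)\<^sup>2 + (R $ 2 $ 1)\<^sup>2 = 1"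
    using w eq by (simp_all add: x_y_z_w_def power2_eq_square)
qed

text \<open>If M has determinant 1 and Q is the quarter turn, then M^{-1} Q M = Q M^T M. So a
  rotation c I + s Q pulls back to P = c I + s Q M^T M, and the off-diagonal entries of P are
  diagonal entries of the Gram matrix M^T M. The proof works with R M = M P, which keeps the inverse
  out of the computation.\<close>

lemma conj_to_SO2_entries:
  assumes "conj_to_SO2 M P"
  obtains s where "P $ 1 $ 2 = - s * ((M $ 1 $ 2)\<^sup>2 + (M $ 2 $ 2)\<^sup>2)"
    "P $ 2 $ 1 = s * ((M $ 1 $ 1)\<^sup>2 + (M $ 2 $ 1)\<^sup>2)" "s\<^sup>2 = 1 - (trace P)\<^sup>2 / 4"
proof -
  define R where "R = M ** P ** matrix_inv M"
  have dM: "det M = 1" and R: "in_SO2 R"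
    using assms by (auto simp: conj_to_SO2_def R_def)
  have "R ** M = M ** P"
    unfolding R_def using matrix_inv_of_det_1[OF dM] by (simp add: matrix_mul_assoc[symmetric])
  then have eq: "R $ i $ 1 * M $ 1 $ j + R $ i $ 2 * M $ 2 $ j = M $ i $ 1 * P $ 1 $ j + M $ i $ 2 * P $ 2 $ j" for i j
    by (metis matrix_mult_2)
  define m1 m2 m3 m4 where m: "m1 = M $ 1 $ 1" "m2 = M $ 1 $ 2" "m3 = M $ 2 $ 1" "m4 = M $ 2 $ 2"
  define p1 p2 p3 p4 where p: "p1 = P $ 1 $ 1" "p2 = P $ 1 $ 2" "p3 = P $ 2 $ 1" "p4 = P $ 2 $ 2"
  define c s where cs: "c = R $ 1 $ 1" "s = R $ 2 $ 1"
  have d: "m1 * m4 - m2 * m3 = 1" using dM by (simp add: det_2 m)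
  have e: "c * m1 - s * m3 = m1 * p1 + m2 * p3" "s * m1 + c * m3 = m3 * p1 + m4 * p3"
     "c * m2 - s * m4 = m1 * p2 + m2 * p4" "s * m2 + c * m4 = m3 * p2 + m4 * p4"
    using eq[of 1 1] eq[of 2 1] eq[of 1 2] eq[of 2 2] in_SO2_entries[OF R]
    by (simp_all add: m p cs)
  have cs1: "c\<^sup>2 + s\<^sup>2 = 1" using in_SO2_entries[OF R] by (simp add: cs)
  have p3: "p3 = s * (m1\<^sup>2 + m3\<^sup>2)"
  proof -
    \<comment> \<open>Cramer's rule with determinant 1: the two equations for a column of M P are
      combined so that the other unknown cancels.\<close>
    have "p3 = (m1 * m4 - m2 * m3) * p3" using d by simp
    also have "\<dots> = m1 * (m3 * p1 + m4 * p3) - m3 * (m1 * p1 + m2 * p3)" by algebra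
    also have "\<dots> = s * (m1\<^sup>2 + m3\<^sup>2)" unfolding e[symmetric] by algebra
    finally show ?thesis .
  qed
  have p2: "p2 = - s * (m2\<^sup>2 + m4\<^sup>2)"
  proof -
    have "p2 = (m1 * m4 - m2 * m3) * p2" using d by simp
    also have "\<dots> = m4 * (m1 * p2 + m2 * p4) - m2 * (m3 * p2 + m4 * p4)" by algebra
    also have "\<dots> = - s * (m2\<^sup>2 + m4\<^sup>2)" unfolding e[symmetric] by algebra
    finally show ?thesis .
  qed
  have "p1 + p4 = (m1 * m4 - m2 * m3) * (p1 + p4)" using d by simp
  also have "\<dots> = m4 * (m1 * p1 + m2 * p3) - m2 * (m3 * p1 + m4 * p3)
      + (m1 * (m3 * p2 + m4 * p4) - m3 * (m1 * p2 + m2 * p4))" by algebra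
  also have "\<dots> = 2 * c * (m1 * m4 - m2 * m3)" unfolding e[symmetric] by algebra
  finally have tr: "p1 + p4 = 2 * c" using d by simp
  have "s\<^sup>2 = 1 - (p1 + p4)\<^sup>2 / 4"
    unfolding tr using cs1 by (simp add: power_mult_distrib)
  then show ?thesis
    using that[of s] p2 p3 by (simp add: m p trace_2)
qed

lemma sqrt_one_minus_pos:
  fixes x :: real
  assumes "\<bar>x\<bar> < 2"
  shows "sqrt (1 - x\<^sup>2 / 4) > 0"
proof -
  have "x\<^sup>2 < 2\<^sup>2" using assms abs_le_square_iff[of 2 x] by linarith
  then show ?thesis by simp
qed

section \<open>Monodromy matrices and the signs of their off-diagonal entries\<close>

locale jacobi_period =
  fixes p :: nat and a b :: "int \<Rightarrow> real"
  assumes periodic: "periodic_jacobi p a b"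
begin

lemma p_pos: "p \<ge> 1" "p > 0"
  and a_pos: "a n > 0" and a_nz: "a n \<noteq> 0"
  and a_per: "a (n + int p) = a n" and b_per: "b (n + int p) = b n"
  using periodic by (auto simp: periodic_jacobi_def less_imp_neq[THEN not_sym])

text \<open>The columns of \<open>Amat\<close> are the orbits of the two unit vectors. Through this
  the discriminant, a trace of real matrices, extends to complex energies.\<close>

lemma Amat_orbit:
  "Amat a b E n $ 1 $ 1 = fst (orbit a b E (1, 0) n)" "Amat a b E n $ 2 $ 1 = snd (orbit a b E (1, 0) n)"
  "Amat a b E n $ 1 $ 2 = fst (orbit a b E (0, 1) n)" "Amat a b E n $ 2 $ 2 = snd (orbit a b E (0, 1) n)"
proof (induction n)
  case (Suc n)
  {
    case 1 show ?case using a_nz[of "int (Suc n)"] Suc by (simp add: matrix_mult_2 transfer_def field_simps)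
  next
    case 2 show ?case using a_nz[of "int (Suc n)"] Suc by (simp add: matrix_mult_2 transfer_def field_simps power2_eq_square)
  next
    case 3 show ?case using a_nz[of "int (Suc n)"] Suc by (simp add: matrix_mult_2 transfer_def field_simps)
  next
    case 4 show ?case using a_nz[of "int (Suc n)"] Suc by (simp add: matrix_mult_2 transfer_def field_simps power2_eq_square)
  }
qed (simp_all add: mat_def)

lemma discr_orbit: "discr p a b E = fst (orbit a b E (1, 0) p) + snd (orbit a b E (0, 1) p)"
  by (simp add: discr_def trace_2 Amat_orbit)

lemma det_transfer: "det (transfer a b E j) = 1"
  using a_nz[of "int j"] by (simp add: det_2 transfer_def power2_eq_square)

lemma det_Amat: "det (Amat a b E n) = 1"
  by (induction n) (simp_all add: det_mul det_transfer)

lemmas Amat_inv = matrix_inv_of_det_1[OF det_Amat]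

text \<open>The definition of \<open>Phi\<close> cleared of its inverse: the determinant and the
  step from j to j+1 then follow by cancellation.\<close>

lemma Phi_intertwine: "Phi p a b E (Suc j) ** Amat a b E j = Amat a b E j ** Amat a b E p"
  by (simp add: Phi_def matrix_mul_assoc[symmetric] Amat_inv)

lemma det_Phi: "det (Phi p a b E (Suc j)) = 1"
  using arg_cong[OF Phi_intertwine, of det E j] by (simp add: det_mul det_Amat)

lemma trace_Phi: "trace (Phi p a b E (Suc j)) = discr p a b E"
  unfolding Phi_def discr_def
  by (subst trace_mul_sym) (simp add: matrix_mul_assoc Amat_inv)

lemma Phi_Suc: "Phi p a b E (Suc (Suc j)) ** transfer a b E (Suc j) = transfer a b E (Suc j) ** Phi p a b E (Suc j)"
proof -
  have "Phi p a b E (Suc (Suc j)) ** transfer a b E (Suc j) ** Amat a b E j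
      = transfer a b E (Suc j) ** Phi p a b E (Suc j) ** Amat a b E j"
    using Phi_intertwine[of E "Suc j"] by (simp add: matrix_mul_assoc[symmetric] Phi_intertwine)
  then have "Phi p a b E (Suc (Suc j)) ** transfer a b E (Suc j) ** (Amat a b E j ** matrix_inv (Amat a b E j))
      = transfer a b E (Suc j) ** Phi p a b E (Suc j) ** (Amat a b E j ** matrix_inv (Amat a b E j))"
    by (simp only: matrix_mul_assoc)
  then show ?thesis by (simp add: Amat_inv)
qed

text \<open>The transfer matrix has 0 in its lower right corner, so the 22 entry of
  \<open>Phi_Suc\<close> contains a single entry of each of the two \<open>Phi\<close>.\<close>

lemma Phi_21_Suc: "Phi p a b E (Suc (Suc j)) $ 2 $ 1 = - (a (int (Suc j)))\<^sup>2 * Phi p a b E (Suc j) $ 1 $ 2"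
proof -
  have "(Phi p a b E (Suc (Suc j)) ** transfer a b E (Suc j)) $ 2 $ 2 = (transfer a b E (Suc j) ** Phi p a b E (Suc j)) $ 2 $ 2"
    by (simp only: Phi_Suc)
  then show ?thesis
    using a_nz[of "int (Suc j)"]
    by (simp add: matrix_mult_2 transfer_def field_simps power2_eq_square)
qed

lemma Phi_periodic: "Phi p a b E (Suc p) = Phi p a b E 1"
  using Amat_inv[of E 0] by (simp add: Phi_def matrix_mul_assoc[symmetric] Amat_inv)

text \<open>A trace in (-2,2) keeps the product of the diagonal entries below 1, by 4xw = (x+w)^2 -
  (x-w)^2; determinant 1 then makes the off-diagonal product negative.\<close>

lemma Phi_off_diag:
  assumes "\<bar>discr p a b E\<bar> < 2"
  shows "Phi p a b E (Suc j) $ 1 $ 2 * Phi p a b E (Suc j) $ 2 $ 1 < 0"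
proof -
  define x w where "x = Phi p a b E (Suc j) $ 1 $ 1" "w = Phi p a b E (Suc j) $ 2 $ 2"
  have "\<bar>x + w\<bar> < 2"
    using trace_Phi[of E j] assms by (simp add: trace_2 x_w_def)
  then have "(x + w)\<^sup>2 < 2\<^sup>2"
    using abs_le_square_iff[of 2 "x + w"] by linarith
  moreover have "4 * (x * w) = (x + w)\<^sup>2 - (x - w)\<^sup>2" by algebra
  moreover have "(x - w)\<^sup>2 \<ge> 0" by simp
  ultimately have "x * w < 1" by (simp only: power2_eq_square)
  then show ?thesis
    using det_Phi[of E j] by (simp add: det_2 x_w_def)
qed

text \<open>The constant matrix N = mat2 0 0 (-1) 0 satisfies T' = T N for the derivative T' of a transfer matrix T in E.\<close>
fun dAmat :: "real \<Rightarrow> nat \<Rightarrow> real^2^2" where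
  "dAmat E 0 = 0"
| "dAmat E (Suc n) = transfer a b E (Suc n) ** (mat2 0 0 (-1) 0 ** Amat a b E n + dAmat E n)"

text \<open>The recursion couples the two entries of a column, so they are differentiated in one
  induction.\<close>

lemma Amat_has_derivative:
  "((\<lambda>E. Amat a b E n $ 1 $ j) has_real_derivative dAmat E n $ 1 $ j) (at E) \<and>
   ((\<lambda>E. Amat a b E n $ 2 $ j) has_real_derivative dAmat E n $ 2 $ j) (at E)"
proof (induction n)
  case (Suc n)
  have a0: "a (1 + int n) \<noteq> 0" by (rule a_nz)
  have eq: "Amat a b E (Suc n) $ 1 $ j = ((E - b (1 + int n)) * Amat a b E n $ 1 $ j - Amat a b E n $ 2 $ j) / a (1 + int n)"
    "Amat a b E (Suc n) $ 2 $ j = a (1 + int n) * Amat a b E n $ 1 $ j" for E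
    using a0 by (simp_all add: matrix_mult_2 transfer_def power2_eq_square) (simp add: field_simps)
  have deq: "dAmat E (Suc n) $ 1 $ j = (Amat a b E n $ 1 $ j + (E - b (1 + int n)) * dAmat E n $ 1 $ j - dAmat E n $ 2 $ j) / a (1 + int n)"
    "dAmat E (Suc n) $ 2 $ j = a (1 + int n) * dAmat E n $ 1 $ j"
    using a0 by (simp_all add: matrix_mult_2 transfer_def power2_eq_square) (simp add: field_simps)
  note d = Suc[THEN conjunct1] Suc[THEN conjunct2]
  show ?case
    unfolding eq deq
  proof (intro conjI DERIV_cdivide DERIV_cmult d)
    show "((\<lambda>E. (E - b (1 + int n)) * Amat a b E n $ 1 $ j - Amat a b E n $ 2 $ j) has_real_derivative
        Amat a b E n $ 1 $ j + (E - b (1 + int n)) * dAmat E n $ 1 $ j - dAmat E n $ 2 $ j) (at E)"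
      by (rule derivative_eq_intros d refl)+ simp
  qed
qed simp

text \<open>Leibniz rule: differentiating the factor T_{j+1} of the product inserts N directly to
  its right, between A_n A_j^{-1} and A_j.\<close>

lemma dAmat_eq:
  "dAmat E n = (\<Sum>j<n. Amat a b E n ** matrix_inv (Amat a b E j) ** mat2 0 0 (-1) 0 ** Amat a b E j)"
proof (induction n)
  case (Suc n)
  have "transfer a b E (Suc n) ** (mat2 0 0 (-1) 0 ** Amat a b E n)
      = Amat a b E (Suc n) ** matrix_inv (Amat a b E n) ** mat2 0 0 (-1) 0 ** Amat a b E n"
    by (simp add: matrix_mul_assoc)
       (simp add: matrix_mul_assoc[symmetric] Amat_inv)
  then show ?case
    by (simp add: Suc matrix_add_ldistrib matrix_mul_sum_right matrix_mul_assoc)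
qed simp

text \<open>By cyclicity of the trace the Leibniz term with index j is the trace of N Phi_{j+1}, and
  multiplication by N extracts minus the 12 entry.\<close>

lemma discr_has_derivative:
  "((discr p a b) has_real_derivative (\<Sum>j=1..p. - Phi p a b E j $ 1 $ 2)) (at E)"
proof -
  have "((\<lambda>E. Amat a b E p $ 1 $ 1 + Amat a b E p $ 2 $ 2) has_real_derivative trace (dAmat E p)) (at E)"
    unfolding trace_2 using Amat_has_derivative by (intro derivative_intros) auto
  moreover have "trace (dAmat E p) = (\<Sum>j<p. - Phi p a b E (Suc j) $ 1 $ 2)"
  proof -
    have tr: "trace (\<Sum>j\<in>I. f j) = (\<Sum>j\<in>I. trace (f j))" for I and f :: "nat \<Rightarrow> real^2^2"
      by (simp add: trace_2 sum_component sum.distrib)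
    have "trace (Amat a b E p ** matrix_inv (Amat a b E j) ** mat2 0 0 (-1) 0 ** Amat a b E j)
        = - Phi p a b E (Suc j) $ 1 $ 2" for j
    proof -
      have "trace (Amat a b E p ** matrix_inv (Amat a b E j) ** mat2 0 0 (-1) 0 ** Amat a b E j)
          = trace ((Amat a b E p ** matrix_inv (Amat a b E j)) ** (mat2 0 0 (-1) 0 ** Amat a b E j))"
        by (simp add: matrix_mul_assoc)
      also have "\<dots> = trace (mat2 0 0 (-1) 0 ** Phi p a b E (Suc j))"
        by (subst trace_mul_sym) (simp add: matrix_mul_assoc Phi_def)
      finally show ?thesis by (simp add: trace_2 matrix_mult_2)
    qed
    then show ?thesis by (simp add: dAmat_eq tr)
  qed
  moreover have "(\<Sum>j<p. - Phi p a b E (Suc j) $ 1 $ 2) = (\<Sum>j=1..p. - Phi p a b E j $ 1 $ 2)"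
    by (rule sum.reindex_bij_witness[of _ "\<lambda>j. j - 1" Suc]) auto
  ultimately show ?thesis by (simp add: discr_def[abs_def] trace_2)
qed

text \<open>All (Phi_j)_21 have one common sign and all (Phi_j)_12 the opposite one, so the terms of
  D' cannot cancel. The number \<open>t j\<close> is |(Phi_j)_12|. The matrices \<open>M\<close> are
  quantified inside the conclusion because \<open>d\<close> and \<open>t\<close> do not depend on
  them.\<close>

lemma discr_derivative_hs_norm:
  assumes D: "\<bar>discr p a b E\<bar> < 2"
  obtains d t where "((discr p a b) has_real_derivative d) (at E)" "d \<noteq> 0"
    "\<And>j. j \<in> {1..p} \<Longrightarrow> t j > 0" "\<bar>d\<bar> = (\<Sum>j=1..p. t j)"
    "\<And>M. (\<And>j. j \<in> {1..p} \<Longrightarrow> conj_to_SO2 (M j) (Phi p a b E j)) \<Longrightarrow>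
      (\<Sum>j=1..p. hs_norm_sq (M j)) = (\<Sum>j=1..p. (1 + (a (int j))\<^sup>2) * t j) / sqrt (1 - (discr p a b E)\<^sup>2 / 4)"
proof -
  define \<sigma> where "\<sigma> = sgn (Phi p a b E 1 $ 2 $ 1)"
  define \<omega> where "\<omega> = sqrt (1 - (discr p a b E)\<^sup>2 / 4)"
  have \<omega>: "\<omega> > 0" "\<omega>\<^sup>2 = 1 - (discr p a b E)\<^sup>2 / 4"
    using sqrt_one_minus_pos[OF D] by (simp_all add: \<omega>_def)
  have "Phi p a b E 1 $ 2 $ 1 \<noteq> 0"
    using Phi_off_diag[OF D, of 0] by auto
  then have \<sigma>: "\<sigma> = 1 \<or> \<sigma> = -1" by (auto simp: \<sigma>_def sgn_real_def)
  \<comment> \<open>The sign survives two reversals: (Phi_j)_12 is opposite to (Phi_j)_21, and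
    \<open>Phi_21_Suc\<close> reverses once more.\<close>
  have sgn21: "\<sigma> * Phi p a b E (Suc j) $ 2 $ 1 > 0" for j
  proof (induction j)
    case 0 then show ?case using \<open>Phi p a b E 1 $ 2 $ 1 \<noteq> 0\<close> by (simp add: \<sigma>_def sgn_real_def)
  next
    case (Suc j)
    have "\<sigma> * (- Phi p a b E (Suc j) $ 1 $ 2) > 0"
      using Suc Phi_off_diag[OF D, of j] \<sigma> by (auto simp: mult_less_0_iff)
    then have "(a (int (Suc j)))\<^sup>2 * (\<sigma> * (- Phi p a b E (Suc j) $ 1 $ 2)) > 0"
      by (rule mult_pos_pos[rotated]) (use a_nz[of "int (Suc j)"] in simp)
    also have "(a (int (Suc j)))\<^sup>2 * (\<sigma> * (- Phi p a b E (Suc j) $ 1 $ 2))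
        = \<sigma> * Phi p a b E (Suc (Suc j)) $ 2 $ 1"
      unfolding Phi_21_Suc by algebra
    finally show ?case .
  qed
  define t where "t j = - \<sigma> * Phi p a b E j $ 1 $ 2" for j
  have t: "t j > 0" if j: "j \<in> {1..p}" for j
  proof -
    obtain i where "j = Suc i" using j by (cases j) auto
    then show ?thesis
      using sgn21[of i] Phi_off_diag[OF D, of i] \<sigma> by (auto simp: t_def mult_less_0_iff)
  qed
  define d where "d = (\<Sum>j=1..p. - Phi p a b E j $ 1 $ 2)"
  have \<sigma>d: "\<sigma> * d = (\<Sum>j=1..p. t j)"
    by (simp add: d_def t_def sum_distrib_left)
  have pos: "(\<Sum>j=1..p. t j) > 0"
    using t p_pos by (intro sum_pos) auto
  have dabs: "\<bar>d\<bar> = (\<Sum>j=1..p. t j)" "d \<noteq> 0"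
    using \<sigma>d pos \<sigma> by auto
  show ?thesis
  proof (rule that[of d t])
    show "((discr p a b) has_real_derivative d) (at E)"
      unfolding d_def by (rule discr_has_derivative)
    fix M assume M: "\<And>j. j \<in> {1..p} \<Longrightarrow> conj_to_SO2 (M j) (Phi p a b E j)"
    have hs: "hs_norm_sq (M j) = (\<sigma> * Phi p a b E j $ 2 $ 1 + t j) / \<omega>" if j: "j \<in> {1..p}" for j
    proof -
      obtain i where i: "j = Suc i" using j by (cases j) auto
      obtain s where s: "Phi p a b E j $ 1 $ 2 = - s * ((M j $ 1 $ 2)\<^sup>2 + (M j $ 2 $ 2)\<^sup>2)"
        "Phi p a b E j $ 2 $ 1 = s * ((M j $ 1 $ 1)\<^sup>2 + (M j $ 2 $ 1)\<^sup>2)"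
        "s\<^sup>2 = 1 - (trace (Phi p a b E j))\<^sup>2 / 4"
        using conj_to_SO2_entries[OF M[OF j]] .
      have "s\<^sup>2 = \<omega>\<^sup>2" using s(3) \<omega>(2) trace_Phi[of E i] by (simp add: i)
      then have "s = \<omega> \<or> s = - \<omega>" by (simp add: power2_eq_iff)
      \<comment> \<open>The trace fixes the sine \<open>s\<close> only up to sign; the known sign of
        the 21 entry, which is \<open>s\<close> times a sum of squares, decides.\<close>
      moreover have "\<sigma> * s > 0"
      proof (rule ccontr)
        assume "\<not> \<sigma> * s > 0"
        then have "\<sigma> * s \<le> 0" by simp
        then have "\<sigma> * s * ((M j $ 1 $ 1)\<^sup>2 + (M j $ 2 $ 1)\<^sup>2) \<le> 0"
          by (rule mult_nonpos_nonneg) simp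
        then show False using sgn21[of i] s(2) by (simp add: i mult.assoc)
      qed
      ultimately have "\<sigma> * s = \<omega>" using \<sigma> \<omega>(1) by auto
      then have "\<omega> * hs_norm_sq (M j) = \<sigma> * s * hs_norm_sq (M j)" by simp
      also have "\<dots> = \<sigma> * Phi p a b E j $ 2 $ 1 + t j"
        unfolding t_def s(1,2) hs_norm_sq_2 by algebra
      finally show ?thesis using \<omega>(1) by (simp add: field_simps)
    qed
    \<comment> \<open>Over a full period the index may be moved by one, as Phi_{p+1} = Phi_1.
      Afterwards \<open>Phi_21_Suc\<close> expresses every 21 entry by \<open>t j\<close>, which
      produces the weights 1 + a_j^2.\<close>
    have "(\<Sum>j=1..p. \<sigma> * Phi p a b E j $ 2 $ 1) = (\<Sum>j=1..p. \<sigma> * Phi p a b E (Suc j) $ 2 $ 1)"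
    proof -
      have "(\<Sum>j=1..p. \<sigma> * Phi p a b E (Suc j) $ 2 $ 1) = (\<Sum>j=Suc 1..Suc p. \<sigma> * Phi p a b E j $ 2 $ 1)"
        by (rule sum.shift_bounds_cl_Suc_ivl[symmetric])
      also have "\<dots> = (\<Sum>j=1..p. \<sigma> * Phi p a b E j $ 2 $ 1)"
        using p_pos by (subst (2) sum.atLeast_Suc_atMost) (simp_all add: Phi_periodic add.commute)
      finally show ?thesis by simp
    qed
    also have "\<dots> = (\<Sum>j=1..p. (a (int j))\<^sup>2 * t j)"
    proof (rule sum.cong[OF refl])
      fix j assume "j \<in> {1..p}"
      then obtain i where "j = Suc i" by (cases j) auto
      then show "\<sigma> * Phi p a b E (Suc j) $ 2 $ 1 = (a (int j))\<^sup>2 * t j"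
        using Phi_21_Suc[of E i] by (simp add: t_def)
    qed
    finally have "(\<Sum>j=1..p. \<sigma> * Phi p a b E j $ 2 $ 1 + t j) = (\<Sum>j=1..p. (1 + (a (int j))\<^sup>2) * t j)"
      by (simp add: sum.distrib distrib_right)
    then show "(\<Sum>j=1..p. hs_norm_sq (M j)) = (\<Sum>j=1..p. (1 + (a (int j))\<^sup>2) * t j) / sqrt (1 - (discr p a b E)\<^sup>2 / 4)"
      using hs by (simp add: sum_divide_distrib[symmetric] \<omega>_def)
  qed (use t dabs in auto)
qed

lemma discr_derivative_nonzero:
  assumes "\<bar>discr p a b E\<bar> < 2" "(discr p a b has_real_derivative d) (at E)"
  shows "d \<noteq> 0"
proof (rule discr_derivative_hs_norm[OF assms(1)])
  fix d' assume "(discr p a b has_real_derivative d') (at E)" "d' \<noteq> 0"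
  then show "d \<noteq> 0" using DERIV_unique[OF assms(2)] by blast
qed

end

section \<open>Quasi-periodic solutions\<close>

lemma orbit_linear:
  fixes E x y :: "'a::real_field"
  shows "orbit a b E (x, y) n =
    (x * fst (orbit a b E (1, 0) n) + y * fst (orbit a b E (0, 1) n),
     x * snd (orbit a b E (1, 0) n) + y * snd (orbit a b E (0, 1) n))"
  by (induction n) (auto simp: diff_divide_distrib add_divide_distrib algebra_simps)

lemma orbit_of_real:
  "orbit a b (of_real E :: 'a::real_field) (of_real x, of_real y) n =
    (of_real (fst (orbit a b E (x, y) n)), of_real (snd (orbit a b E (x, y) n)))"
  by (induction n) auto

fun orbit_poly :: "(int \<Rightarrow> real) \<Rightarrow> (int \<Rightarrow> real) \<Rightarrow> complex \<times> complex \<Rightarrow> nat \<Rightarrow> complex poly \<times> complex poly" where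
  "orbit_poly a b v 0 = ([:fst v:], [:snd v:])"
| "orbit_poly a b v (Suc n) =
    (smult (1 / of_real (a (int (Suc n)))) ([:- of_real (b (int (Suc n))), 1:] * fst (orbit_poly a b v n) - snd (orbit_poly a b v n)),
     smult (of_real (a (int (Suc n)))) (fst (orbit_poly a b v n)))"

lemma poly_orbit_poly:
  "poly (fst (orbit_poly a b v n)) E = fst (orbit a b E v n)"
  "poly (snd (orbit_poly a b v n)) E = snd (orbit a b E v n)"
  by (induction n) (simp_all add: diff_divide_distrib add_divide_distrib left_diff_distrib)

text \<open>The second component is a multiple of the preceding first one and so lags by one degree;
  at n = 0 both are constants, in agreement with truncated subtraction.\<close>

lemma degree_orbit_poly:
  "degree (fst (orbit_poly a b v n)) \<le> n \<and> degree (snd (orbit_poly a b v n)) \<le> n - 1"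
proof (induction n)
  case (Suc n)
  have "degree ([:- of_real (b (int (Suc n))), 1:] * fst (orbit_poly a b v n)) \<le> Suc n"
    by (rule order_trans[OF degree_mult_le]) (use Suc in \<open>auto intro: le_trans[OF add_mono]\<close>)
  moreover have "degree (snd (orbit_poly a b v n)) \<le> Suc n" using Suc by linarith
  ultimately have "degree ([:- of_real (b (int (Suc n))), 1:] * fst (orbit_poly a b v n) - snd (orbit_poly a b v n)) \<le> Suc n"
    by (rule degree_diff_le)
  then show ?case
    using Suc by (auto intro: order_trans[OF degree_smult_le])
qed simp

section \<open>The discriminant as a complex polynomial, and Bloch solutions\<close>

context jacobi_period
begin

text \<open>The leading coefficient is 1 / (a_1 ... a_n).\<close>

lemma coeff_orbit_poly: "coeff (fst (orbit_poly a b (1, 0) n)) n \<noteq> 0"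
proof (induction n)
  case (Suc n)
  have "coeff (snd (orbit_poly a b (1, 0) n)) (Suc n) = 0"
    using degree_orbit_poly[of a b "(1, 0)" n] by (intro coeff_eq_0) linarith
  moreover have "coeff (fst (orbit_poly a b (1, 0) n)) (Suc n) = 0"
    using degree_orbit_poly[of a b "(1, 0)" n] by (intro coeff_eq_0) linarith
  ultimately show ?case
    using Suc a_nz[of "int (Suc n)"] by simp
qed simp

definition discr_poly :: "complex poly" where
  "discr_poly = fst (orbit_poly a b (1, 0) p) + snd (orbit_poly a b (0, 1) p)"

lemma degree_discr_poly: "degree discr_poly = p"
proof -
  have "degree (fst (orbit_poly a b (1, 0) p)) = p"
    using degree_orbit_poly[of a b "(1, 0)" p] coeff_orbit_poly[of p] le_degree by (intro antisym) blast+
  moreover have "degree (snd (orbit_poly a b (0, 1) p)) < p"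
    using degree_orbit_poly[of a b "(0, 1)" p] p_pos by linarith
  ultimately show ?thesis
    unfolding discr_poly_def by (simp add: degree_add_eq_left)
qed

lemma poly_discr_poly: "poly discr_poly E = fst (orbit a b E (1, 0) p) + snd (orbit a b E (0, 1) p)"
  by (simp add: discr_poly_def poly_orbit_poly)

lemma poly_discr_poly_of_real: "poly discr_poly (of_real E) = of_real (discr p a b E)"
  using orbit_of_real[where 'a = complex, of a b E 1 0 p] orbit_of_real[where 'a = complex, of a b E 0 1 p]
  by (simp add: poly_discr_poly discr_orbit)

text \<open>Carries the nonvanishing of the real derivative over to the polynomial, where it says
  that a real root is simple.\<close>

lemma pderiv_discr_poly_of_real:
  assumes "((discr p a b) has_real_derivative d) (at E)"
  shows "poly (pderiv discr_poly) (of_real E) = of_real d"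
proof -
  have "((\<lambda>x. poly discr_poly (of_real x)) has_vector_derivative poly (pderiv discr_poly) (of_real E)) (at E)"
    by (rule has_vector_derivative_real_field) (rule poly_DERIV)
  moreover have "((\<lambda>x. poly discr_poly (of_real x)) has_vector_derivative of_real d) (at E)"
    unfolding poly_discr_poly_of_real
    using assms by (intro has_vector_derivative_of_real) (simp add: has_real_derivative_iff_has_vector_derivative)
  ultimately show ?thesis by (rule vector_derivative_unique_at)
qed

lemma a_per_mult: "a (n + int p * int L) = a n" and b_per_mult: "b (n + int p * int L) = b n"
proof -
  have "a (n + int p * int L) = a n \<and> b (n + int p * int L) = b n"
  proof (induction L)
    case (Suc L)
    then show ?case
      using a_per[of "n + int p * int L"] b_per[of "n + int p * int L"] by (simp add: algebra_simps)
  qed simp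
  then show "a (n + int p * int L) = a n" "b (n + int p * int L) = b n" by auto
qed

lemma orbit_add: "orbit a b E v (n + p) = orbit a b E (orbit a b E v p) n"
proof (induction n)
  case (Suc n)
  then show ?case
    using a_per[of "int (Suc n)"] b_per[of "int (Suc n)"] by (simp add: add_ac)
qed simp

lemma orbit_det:
  fixes E :: "'a::real_field"
  shows "fst (orbit a b E (1, 0) n) * snd (orbit a b E (0, 1) n) - fst (orbit a b E (0, 1) n) * snd (orbit a b E (1, 0) n) = 1"
proof (induction n)
  case (Suc n)
  have "of_real (a (1 + int n)) \<noteq> (0 :: 'a)" using a_nz by simp
  then show ?case using Suc by (simp add: field_simps)
qed simp

definition bloch :: "complex \<Rightarrow> complex \<Rightarrow> (int \<Rightarrow> complex) \<Rightarrow> bool" where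
  "bloch z E u \<longleftrightarrow>
    (\<forall>n. of_real (a (n - 1)) * u (n - 1) + of_real (b n) * u n + of_real (a n) * u (n + 1) = E * u n) \<and>
    (\<forall>n. u (n + int p) = z * u n)"

text \<open>With determinant 1, a trace equal to z + 1/z makes z a root of the characteristic
  polynomial. The vectors (B, z - A) and (z - D, C) are eigenvectors as soon as B resp. C is
  nonzero, which leaves the diagonal case apart.\<close>

lemma monodromy_eigenvector:
  assumes "z \<noteq> 0" "poly discr_poly E = z + 1 / z"
  obtains x y where "(x, y) \<noteq> (0, 0)" "orbit a b E (x, y) p = (z * x, z * y)"
proof -
  define A B C D where d: "A = fst (orbit a b E (1, 0) p)" "B = fst (orbit a b E (0, 1) p)"
    "C = snd (orbit a b E (1, 0) p)" "D = snd (orbit a b E (0, 1) p)"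
  have det: "A * D - B * C = 1" using orbit_det[of E p] by (simp add: d)
  have "A + D = z + 1 / z" using assms(2) by (simp add: poly_discr_poly d)
  then have "z * (A + D) = z * z + 1" using assms(1) by (simp add: field_simps)
  then have char: "z * z - z * (A + D) + (A * D - B * C) = 0" using det by simp
  have "\<exists>x y. (x, y) \<noteq> (0, 0) \<and> x * A + y * B = z * x \<and> x * C + y * D = z * y"
  proof (cases "B = 0 \<and> C = 0")
    case True
    then have "(z - A) * (z - D) = 0" using char by (simp add: algebra_simps)
    then have "z = A \<or> z = D" by auto
    then show ?thesis
    proof
      assume "z = A" then show ?thesis using True by (intro exI[of _ 1] exI[of _ 0]) simp
    next
      assume "z = D" then show ?thesis using True by (intro exI[of _ 0] exI[of _ 1]) simp
    qed
  next
    case False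
    then consider "B \<noteq> 0" | "C \<noteq> 0" by blast
    then show ?thesis
    proof cases
      case 1
      have "B * C + (z - A) * D = z * (z - A)" using char by algebra
      then show ?thesis using 1 by (intro exI[of _ B] exI[of _ "z - A"]) (simp add: algebra_simps)
    next
      case 2
      have "(z - D) * A + C * B = z * (z - D)" using char by algebra
      then show ?thesis using 2 by (intro exI[of _ "z - D"] exI[of _ C]) (simp add: algebra_simps)
    qed
  qed
  then obtain x y where "(x, y) \<noteq> (0, 0)" "x * A + y * B = z * x" "x * C + y * D = z * y" by blast
  then show ?thesis
    using that[of x y] orbit_linear[of a b E x y p] by (simp add: d)
qed

text \<open>An eigenvector of the monodromy matrix starts an orbit that is quasi-periodic to the
  right. A value further left is defined by moving it to the right by sufficiently many periods and
  dividing by the corresponding power of z.\<close>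

lemma bloch_exists:
  assumes z: "z \<noteq> 0" "poly discr_poly E = z + 1 / z"
  obtains u where "bloch z E u" "\<exists>n<p. u (int n) \<noteq> 0"
proof -
  obtain x y where xy: "(x, y) \<noteq> (0, 0)" "orbit a b E (x, y) p = (z * x, z * y)"
    using monodromy_eigenvector[OF z] .
  define v where "v n = fst (orbit a b E (x, y) n)" for n
  have v_shift: "v (n + p) = z * v n" for n
    unfolding v_def orbit_add xy(2)
    by (subst orbit_linear, subst (4) orbit_linear) (simp add: algebra_simps)
  have v_shifts: "v (n + p * i) = z ^ i * v n" for n i
  proof (induction i)
    case (Suc i)
    then show ?case using v_shift[of "n + p * i"] by (simp add: algebra_simps)
  qed simp
  have v_rec: "of_real (a (int (Suc n))) * v n + of_real (b (int (Suc (Suc n)))) * v (Suc n)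
      + of_real (a (int (Suc (Suc n)))) * v (Suc (Suc n)) = E * v (Suc n)" for n
  proof -
    have "snd (orbit a b E (x, y) (Suc n)) = of_real (a (int (Suc n))) * v n"
      by (simp add: v_def)
    then have "v (Suc (Suc n)) = ((E - of_real (b (int (Suc (Suc n))))) * v (Suc n) - of_real (a (int (Suc n))) * v n)
        / of_real (a (int (Suc (Suc n))))"
      by (simp only: v_def orbit.simps(2)[of _ _ _ _ "Suc n"] fst_conv)
    then show ?thesis
      using a_nz[of "int (Suc (Suc n))"] by (simp add: left_diff_distrib)
  qed
  \<comment> \<open>The orbit starts with u 1, so \<open>v n\<close> stands for u (n+1), hence the
    \<open>m - 1\<close>. Since p is at least 1, moving by |m| + 1 periods makes the index
    nonnegative.\<close>
  define u where "u m = v (nat (m - 1 + int p * int (nat \<bar>m\<bar> + 1))) / z ^ (nat \<bar>m\<bar> + 1)" for m :: int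
  have big: "m + int p * int L \<ge> 0" if "\<bar>m\<bar> \<le> int L" for m L
  proof -
    have "int L \<le> int p * int L" using p_pos by (simp add: mult_le_cancel_right1)
    then show ?thesis using that by linarith
  qed
  \<comment> \<open>Any number L of periods with a nonnegative index gives the same value: the two
    indices agree after adding p K to one and p L to the other.\<close>
  have u: "u m * z ^ L = v (nat (m - 1 + int p * int L))" if L: "m - 1 + int p * int L \<ge> 0" for m L
  proof -
    define K where "K = nat \<bar>m\<bar> + 1"
    have K: "m - 1 + int p * int K \<ge> 0" by (rule big) (simp add: K_def)
    have "int (nat (m - 1 + int p * int L) + p * K) = int (nat (m - 1 + int p * int K) + p * L)"
      using L K by simp
    then have "nat (m - 1 + int p * int L) + p * K = nat (m - 1 + int p * int K) + p * L"
      by (simp only: of_nat_eq_iff)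
    then have "z ^ K * v (nat (m - 1 + int p * int L)) = z ^ L * v (nat (m - 1 + int p * int K))"
      by (metis v_shifts)
    moreover have "u m * z ^ K = v (nat (m - 1 + int p * int K))"
      using z(1) by (simp add: u_def K_def)
    ultimately have "z ^ K * v (nat (m - 1 + int p * int L)) = z ^ K * (u m * z ^ L)"
      by (simp add: mult_ac)
    then show ?thesis using z(1) by simp
  qed
  have "bloch z E u"
    unfolding bloch_def
  proof (intro conjI allI)
    fix m :: int
    \<comment> \<open>One period more than in the definition of \<open>u\<close>, so that m - 1, m
      and m + 1 can all be moved by the same L.\<close>
    define L where "L = nat \<bar>m\<bar> + 2"
    define k where "k = nat (m - 2 + int p * int L)"
    have k: "int k = m - 2 + int p * int L"
      unfolding k_def using big[of "m - 2" L] by (simp add: L_def)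
    have ik: "m - 1 - 1 + int p * int L = int k" "m - 1 + int p * int L = int (Suc k)"
        "m + 1 - 1 + int p * int L = int (Suc (Suc k))"
      using k by auto
    have e: "u (m - 1) * z ^ L = v k" "u m * z ^ L = v (Suc k)" "u (m + 1) * z ^ L = v (Suc (Suc k))"
      using u[of "m - 1" L] u[of m L] u[of "m + 1" L] unfolding ik nat_int by auto
    have ab: "a (m - 1) = a (int (Suc k))" "a m = a (int (Suc (Suc k)))" "b m = b (int (Suc (Suc k)))"
    proof -
      have "int (Suc k) = m - 1 + int p * int L" "int (Suc (Suc k)) = m + int p * int L"
        using k by auto
      then show "a (m - 1) = a (int (Suc k))" "a m = a (int (Suc (Suc k)))" "b m = b (int (Suc (Suc k)))"
        by (simp_all only: a_per_mult b_per_mult)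
    qed
    have "(of_real (a (m - 1)) * u (m - 1) + of_real (b m) * u m + of_real (a m) * u (m + 1)) * z ^ L
        = of_real (a (m - 1)) * (u (m - 1) * z ^ L) + of_real (b m) * (u m * z ^ L) + of_real (a m) * (u (m + 1) * z ^ L)"
      by (simp only: distrib_right mult.assoc)
    also have "\<dots> = E * (u m * z ^ L)"
      unfolding e ab by (rule v_rec)
    finally show "of_real (a (m - 1)) * u (m - 1) + of_real (b m) * u m + of_real (a m) * u (m + 1) = E * u m"
      using z(1) by (metis mult.assoc mult_cancel_right power_not_zero)
  next
    fix m :: int
    define L where "L = nat \<bar>m\<bar> + 1"
    have L: "m - 1 + int p * int L \<ge> 0" by (rule big) (simp add: L_def)
    have "int p * int L \<le> int p * int (Suc L)" by (intro mult_left_mono) auto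
    then have ge: "m - 1 + int p * int (Suc L) \<ge> 0" using L by linarith
    have shift: "m + int p - 1 + int p * int L = m - 1 + int p * int (Suc L)" by (simp add: algebra_simps)
    have "u (m + int p) * z ^ L = v (nat (m - 1 + int p * int (Suc L)))"
      using u[of "m + int p" L] ge unfolding shift by blast
    also have "\<dots> = u m * z ^ Suc L"
      using u[OF ge] by simp
    finally have "u (m + int p) * z ^ L = (z * u m) * z ^ L" by (simp only: power_Suc mult_ac)
    then show "u (m + int p) = z * u m" using z(1) by (metis mult_cancel_right power_not_zero)
  qed
  \<comment> \<open>Zeros on one period spread to the right through the multiplier, so
    \<open>v 0\<close> and \<open>v 1\<close> vanish; these two values determine x and y.\<close>
  moreover have "\<exists>n<p. u (int n) \<noteq> 0"
  proof (rule ccontr)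
    assume "\<not> ?thesis"
    then have zero: "u (int n) = 0" if "n < p" for n using that by auto
    have "u (int (n + p * i)) = 0" if "n < p" for n i
    proof (induction i)
      case (Suc i)
      have "u (int (n + p * i) + int p) = z * u (int (n + p * i))"
        using \<open>bloch z E u\<close> unfolding bloch_def by blast
      then show ?case using Suc by (simp add: algebra_simps)
    qed (use zero that in simp)
    from this[of "n mod p" "n div p" for n] have all: "u (int n) = 0" for n
      using p_pos by (simp del: of_nat_add of_nat_mult)
    have "v n = 0" for n
      using u[of "int (Suc n)" 0] all[of "Suc n"] by simp
    from this[of 0] this[of 1] show False
      using xy(1) a_nz[of 1] by (simp add: v_def)
  qed
  ultimately show ?thesis by (rule that)
qed

text \<open>The summand times E - cnj E' is the increment of the Wronskian \<open>W\<close> of u and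
  cnj w, and \<open>W\<close> has period p because z has modulus 1. One identity serves twice: w = u
  yields real energies, and distinct real energies yield orthogonality.\<close>

lemma bloch_wronskian:
  assumes u: "bloch z E u" and w: "bloch z E' w" and z: "cmod z = 1"
  shows "(E - cnj E') * (\<Sum>n<p. u (int n) * cnj (w (int n))) = 0"
proof -
  define W where "W n = of_real (a n) * (u (n + 1) * cnj (w n) - u n * cnj (w (n + 1)))" for n
  have ue: "of_real (a (n - 1)) * u (n - 1) + of_real (b n) * u n + of_real (a n) * u (n + 1) = E * u n" for n
    using u by (auto simp: bloch_def)
  have we: "of_real (a (n - 1)) * cnj (w (n - 1)) + of_real (b n) * cnj (w n) + of_real (a n) * cnj (w (n + 1)) = cnj E' * cnj (w n)" for n
  proof -
    have "of_real (a (n - 1)) * w (n - 1) + of_real (b n) * w n + of_real (a n) * w (n + 1) = E' * w n"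
      using w by (auto simp: bloch_def)
    from arg_cong[OF this, of cnj] show ?thesis by simp
  qed
  have diff: "(E - cnj E') * (u n * cnj (w n)) = W n - W (n - 1)" for n
  proof -
    have "(E - cnj E') * (u n * cnj (w n)) = (E * u n) * cnj (w n) - u n * (cnj E' * cnj (w n))"
      by (simp add: algebra_simps)
    also have "\<dots> = W n - W (n - 1)"
      unfolding ue[symmetric] we[symmetric] W_def by (simp add: algebra_simps)
    finally show ?thesis .
  qed
  have zz: "z * cnj z = 1" using z by (simp add: complex_norm_square[symmetric])
  have "W (n + int p) = W n" for n
  proof -
    have per: "u (m + int p) * cnj (w (k + int p)) = u m * cnj (w k)" for m k
    proof -
      have "u (m + int p) = z * u m" "w (k + int p) = z * w k" using u w by (auto simp: bloch_def)
      then have "u (m + int p) * cnj (w (k + int p)) = (z * cnj z) * (u m * cnj (w k))" by simp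
      then show ?thesis using zz by simp
    qed
    show ?thesis
      using per[of "n + 1" n] per[of n "n + 1"] by (simp add: W_def a_per add_ac)
  qed
  \<comment> \<open>Summing the increments over 0, ..., p-1 telescopes from \<open>W (-1)\<close> to
    \<open>W (p - 1)\<close>, exactly one period apart.\<close>
  from this[of "-1"] have "W (int p - 1) = W (-1)" by (simp add: algebra_simps)
  moreover have "(\<Sum>n<p. W (int n) - W (int n - 1)) = W (int p - 1) - W (-1)"
    using sum_lessThan_telescope[of "\<lambda>n. W (int n - 1)" p] by simp
  ultimately show ?thesis by (simp add: sum_distrib_left diff)
qed

lemma bloch_energy_real:
  assumes u: "bloch z E u" "\<exists>n<p. u (int n) \<noteq> 0" and z: "cmod z = 1"
  shows "E \<in> \<real>"
proof -
  have "(\<Sum>n<p. u (int n) * cnj (u (int n))) = of_real (\<Sum>n<p. (cmod (u (int n)))\<^sup>2)"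
    by (simp only: complex_norm_square of_real_sum)
  moreover have "(\<Sum>n<p. (cmod (u (int n)))\<^sup>2) > 0"
  proof -
    obtain n where "n < p" "u (int n) \<noteq> 0" using u(2) by blast
    then show ?thesis by (intro sum_pos2[of _ n]) auto
  qed
  ultimately have "(\<Sum>n<p. u (int n) * cnj (u (int n))) \<noteq> 0"
    by (metis of_real_eq_0_iff less_irrefl)
  then have "E = cnj E"
    using bloch_wronskian[OF u(1) u(1) z] by simp
  then show ?thesis by (simp add: Reals_cnj_iff)
qed

lemma cis_add_inverse: "cis \<phi> + 1 / cis \<phi> = of_real (2 * cos \<phi>)"
  by (simp add: complex_eq_iff divide_inverse cis_inverse)

text \<open>D - c is a complex polynomial of degree p. For c = 2 cos \<phi> every complex root
  carries a Bloch solution with multiplier \<open>cis \<phi>\<close> of modulus 1 and is thus real,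
  where the nonzero derivative makes it simple.\<close>

lemma card_discr_eq:
  assumes c: "\<bar>c\<bar> < 2"
  shows "card {E. discr p a b E = c} = p" "finite {E. discr p a b E = c}"
proof -
  define q where "q = discr_poly - [:of_real c:]"
  define \<phi> where "\<phi> = arccos (c / 2)"
  have \<phi>: "c = 2 * cos \<phi>" using c by (simp add: \<phi>_def cos_arccos)
  have "degree [:complex_of_real c:] < degree discr_poly" using p_pos by (simp add: degree_discr_poly)
  then have deg: "degree q = p"
    unfolding q_def diff_conv_add_uminus by (subst degree_add_eq_left) (simp_all add: degree_discr_poly)
  have real_root: "\<exists>E. w = of_real E \<and> discr p a b E = c" if "poly q w = 0" for w
  proof -
    have "poly discr_poly w = cis \<phi> + 1 / cis \<phi>"
      using that unfolding cis_add_inverse by (simp add: q_def \<phi>)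
    then obtain u where "bloch (cis \<phi>) w u" "\<exists>n<p. u (int n) \<noteq> 0"
      using bloch_exists[of "cis \<phi>" w] by auto
    then have "w \<in> \<real>" using bloch_energy_real by auto
    then obtain E where "w = of_real E" by (auto elim: Reals_cases)
    then show ?thesis
      using that by (auto simp: q_def poly_discr_poly_of_real)
  qed
  have roots: "{w. poly q w = 0} = of_real ` {E. discr p a b E = c}"
    using real_root by (auto simp: q_def poly_discr_poly_of_real)
  have "rsquarefree q"
    unfolding rsquarefree_roots
  proof (intro allI notI)
    fix w assume w: "poly q w = 0 \<and> poly (pderiv q) w = 0"
    then obtain E where E: "w = of_real E" "discr p a b E = c" using real_root by blast
    obtain d where "((discr p a b) has_real_derivative d) (at E)" "d \<noteq> 0"
      using discr_derivative_nonzero[OF _ discr_has_derivative, of E] discr_has_derivative E(2) c by blast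
    then show False
      using w pderiv_discr_poly_of_real by (simp add: E q_def pderiv_diff pderiv_pCons)
  qed
  from complex_poly_decompose_rsquarefree[OF this] have dec: "smult (lead_coeff q) (\<Prod>w | poly q w = 0. [:-w, 1:]) = q" .
  have "q \<noteq> 0" using deg p_pos by auto
  then have "degree q = degree (\<Prod>w | poly q w = 0. [:-w, 1:])"
    by (metis dec degree_smult_eq leading_coeff_0_iff)
  also have "\<dots> = card {w. poly q w = 0}"
    by (subst degree_prod_sum_eq) auto
  also have "\<dots> = card {E. discr p a b E = c}"
    unfolding roots by (rule card_image) (auto simp: inj_on_def)
  finally show "card {E. discr p a b E = c} = p" using deg by simp
  then show "finite {E. discr p a b E = c}" using p_pos by (intro card_ge_0_finite) simp
qed

end

section \<open>Power sums of the roots of the discriminant\<close>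

lemma int_interval_3: "{l - 1..l + 1} = {l - 1, l, l + 1 :: int}"
  by auto

lemma jac_entry_far: "\<bar>m - n\<bar> > 1 \<Longrightarrow> jac_entry a b m n = 0"
  by (auto simp: jac_entry_def)

lemma jac_pow_far: "\<bar>m - n\<bar> > int k \<Longrightarrow> jac_pow a b k m n = 0"
proof (induction k arbitrary: n)
  case (Suc k)
  then have "jac_pow a b k m l = 0" if "l \<in> {n - 1..n + 1}" for l
    using that by (intro Suc.IH) auto
  then show ?case by simp
qed auto

text \<open>Rows of J^k are finite, so \<open>u\<close> need not be square summable. The radius
  \<open>K\<close> stays fixed while k grows, which keeps the range of summation constant during the
  induction.\<close>

lemma jac_pow_eigenvector:
  fixes u :: "int \<Rightarrow> complex"
  assumes eig: "\<And>n. of_real (a (n - 1)) * u (n - 1) + of_real (b n) * u n + of_real (a n) * u (n + 1) = E * u n"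
    and "k \<le> K"
  shows "(\<Sum>n\<in>{m - int K..m + int K}. of_real (jac_pow a b k m n) * u n) = E ^ k * u m"
  using \<open>k \<le> K\<close>
proof (induction k)
  case 0
  have "(\<Sum>n\<in>{m - int K..m + int K}. of_real (jac_pow a b 0 m n) * u n) = (\<Sum>n\<in>{m}. u n)"
    by (rule sum.mono_neutral_cong_right) auto
  then show ?case by simp
next
  case (Suc k)
  define I where "I = {m - int K..m + int K}"
  have row: "jac_pow a b (Suc k) m n = (\<Sum>l\<in>I. jac_pow a b k m l * jac_entry a b l n)" for n
    unfolding jac_pow.simps
  proof (rule sum.mono_neutral_cong)
    show "jac_pow a b k m i * jac_entry a b i n = 0" if "i \<in> I - {n - 1..n + 1}" for i
      using that by (auto intro!: jac_entry_far)
    show "jac_pow a b k m i * jac_entry a b i n = 0" if "i \<in> {n - 1..n + 1} - I" for i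
    proof -
      have "jac_pow a b k m i = 0" using that Suc.prems by (intro jac_pow_far) (auto simp: I_def)
      then show ?thesis by simp
    qed
  qed (auto simp: I_def)
  \<comment> \<open>If l is within k of m, its neighbours lie in the window because k + 1 is at most
    K; otherwise the coefficient in front vanishes.\<close>
  have entry: "of_real (jac_pow a b k m l) * (\<Sum>n\<in>I. of_real (jac_entry a b l n) * u n)
      = of_real (jac_pow a b k m l) * (E * u l)" for l
  proof (cases "\<bar>m - l\<bar> > int k")
    case True
    then show ?thesis by (simp add: jac_pow_far)
  next
    case False
    have "(\<Sum>n\<in>I. of_real (jac_entry a b l n) * u n) = (\<Sum>n\<in>{l - 1..l + 1}. of_real (jac_entry a b l n) * u n)"
    proof (rule sum.mono_neutral_right)
      show "{l - 1..l + 1} \<subseteq> I" using False Suc.prems by (auto simp: I_def)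
      have "jac_entry a b l i = 0" if "i \<in> I - {l - 1..l + 1}" for i
        using that by (intro jac_entry_far) auto
      then show "\<forall>i\<in>I - {l - 1..l + 1}. complex_of_real (jac_entry a b l i) * u i = 0" by simp
    qed (simp add: I_def)
    also have "\<dots> = E * u l"
      unfolding int_interval_3 using eig[of l] by (simp add: jac_entry_def add.assoc)
    finally show ?thesis by simp
  qed
  have "(\<Sum>n\<in>I. of_real (jac_pow a b (Suc k) m n) * u n)
      = (\<Sum>n\<in>I. \<Sum>l\<in>I. of_real (jac_pow a b k m l) * (of_real (jac_entry a b l n) * u n))"
    unfolding row by (simp add: sum_distrib_right mult.assoc)
  also have "\<dots> = (\<Sum>l\<in>I. of_real (jac_pow a b k m l) * (\<Sum>n\<in>I. of_real (jac_entry a b l n) * u n))"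
    by (subst sum.swap) (simp add: sum_distrib_left)
  also have "\<dots> = E * (\<Sum>l\<in>I. of_real (jac_pow a b k m l) * u l)"
    unfolding entry by (simp add: sum_distrib_left mult_ac)
  also have "\<dots> = E ^ Suc k * u m"
    using Suc by (simp add: I_def)
  finally show ?case unfolding I_def .
qed

section \<open>Trace formula for the powers of the energies\<close>

context jacobi_period
begin

lemma bloch_shift:
  assumes "bloch (cis \<phi>) E u"
  shows "u (n + int p * q) = cis (of_int q * \<phi>) * u n"
proof -
  have step: "u (n + int p) = cis \<phi> * u n" for n
    using assms by (auto simp: bloch_def)
  have nat: "u (n + int p * int i) = cis (real i * \<phi>) * u n" for n i
  proof (induction i)
    case (Suc i)
    have "u (n + int p * int (Suc i)) = cis \<phi> * u (n + int p * int i)"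
      using step[of "n + int p * int i"] by (simp add: algebra_simps)
    then show ?case unfolding Suc by (simp add: cis_mult[symmetric] distrib_right mult.assoc)
  qed simp
  show ?thesis
  proof (cases "q \<ge> 0")
    case True
    then show ?thesis using nat[of n "nat q"] by simp
  next
    case False
    have "u n = cis (real (nat (- q)) * \<phi>) * u (n + int p * q)"
      using nat[of "n + int p * q" "nat (- q)"] False by simp
    then have "cis (of_int q * \<phi>) * u n = (cis (of_int q * \<phi>) * cis (- of_int q * \<phi>)) * u (n + int p * q)"
      using False by (simp add: mult.assoc)
    then show ?thesis by (simp add: cis_mult)
  qed
qed

lemma bloch_normalized:
  assumes \<phi>: "discr p a b E = 2 * cos \<phi>"
  obtains u where "bloch (cis \<phi>) (of_real E) u" "(\<Sum>n<p. u (int n) * cnj (u (int n))) = 1"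
proof -
  have "poly discr_poly (of_real E) = cis \<phi> + 1 / cis \<phi>"
    unfolding cis_add_inverse by (simp add: poly_discr_poly_of_real \<phi>)
  then obtain u where u: "bloch (cis \<phi>) (of_real E) u" "\<exists>n<p. u (int n) \<noteq> 0"
    using bloch_exists[OF cis_neq_zero] by blast
  define N where "N = (\<Sum>n<p. (cmod (u (int n)))\<^sup>2)"
  have N: "(\<Sum>n<p. u (int n) * cnj (u (int n))) = of_real N"
    unfolding N_def by (simp only: complex_norm_square of_real_sum)
  have "N > 0"
  proof -
    obtain n where "n < p" "u (int n) \<noteq> 0" using u(2) by blast
    then show ?thesis unfolding N_def by (intro sum_pos2[of _ n]) auto
  qed
  define s :: complex where "s = of_real (1 / sqrt N)"
  have s: "s * cnj s * of_real N = 1"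
    using \<open>N > 0\<close> by (simp add: s_def flip: of_real_mult)
  show ?thesis
  proof (rule that[of "\<lambda>n. s * u n"])
    have "of_real (a (n - 1)) * u (n - 1) + of_real (b n) * u n + of_real (a n) * u (n + 1) = of_real E * u n"
      and "u (n + int p) = cis \<phi> * u n" for n
      using u(1) by (auto simp: bloch_def)
    then show "bloch (cis \<phi>) (of_real E) (\<lambda>n. s * u n)"
      unfolding bloch_def by (metis (no_types, opaque_lifting) distrib_left mult.left_commute)
    have "(\<Sum>n<p. s * u (int n) * cnj (s * u (int n))) = s * cnj s * (\<Sum>n<p. u (int n) * cnj (u (int n)))"
      by (simp add: sum_distrib_left mult_ac)
    then show "(\<Sum>n<p. s * u (int n) * cnj (s * u (int n))) = 1" using s by (simp only: N)
  qed
qed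

text \<open>The trace of the k-th power of the Floquet matrix, computed in two ways. Each E^k is
  multiplied by the squared norm 1 of its Bloch solution, and E^k u(m) is expanded along row m of
  J^k. After exchanging the sums, completeness evaluates the sum over the energies.\<close>

lemma power_sum_discr_roots:
  assumes \<phi>: "0 < \<phi>" "\<phi> < pi"
  shows "(\<Sum>E | discr p a b E = 2 * cos \<phi>. E ^ k) =
    (\<Sum>m<p. \<Sum>n\<in>{int m - int k..int m + int k}. jac_pow a b k (int m) n *
      (if n mod int p = int m then cos (of_int (n div int p) * \<phi>) else 0))"
proof -
  define X where "X = {E. discr p a b E = 2 * cos \<phi>}"
  have "cos \<phi> < 1" "cos \<phi> > - 1"
    using cos_monotone_0_pi[of 0 \<phi>] cos_monotone_0_pi[of \<phi> pi] \<phi> by auto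
  then have "\<bar>2 * cos \<phi>\<bar> < 2" by auto
  from card_discr_eq[OF this] have X: "card X = p" "finite X" by (simp_all add: X_def)
  have "\<exists>u. bloch (cis \<phi>) (of_real E) u \<and> (\<Sum>n<p. u (int n) * cnj (u (int n))) = 1" if "E \<in> X" for E
    using bloch_normalized[of E \<phi>] that unfolding X_def by blast
  then obtain u where u: "\<And>E. E \<in> X \<Longrightarrow> bloch (cis \<phi>) (of_real E) (u E)"
      "\<And>E. E \<in> X \<Longrightarrow> (\<Sum>n<p. u E (int n) * cnj (u E (int n))) = 1"
    by metis
  have on: "(\<Sum>n\<in>{..<p}. u E (int n) * cnj (u F (int n))) = (if E = F then 1 else 0)"
    if "E \<in> X" "F \<in> X" for E F
  proof (cases "E = F")
    case False
    then show ?thesis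
      using bloch_wronskian[OF u(1) u(1), OF that] by simp
  qed (use u(2)[OF that(2)] in simp)
  \<comment> \<open>A site n is its residue in the basic period moved by \<open>n div int p\<close>
    periods; each period contributes a factor \<open>cis \<phi>\<close>, common to all
    energies.\<close>
  have complete: "(\<Sum>E\<in>X. cnj (u E (int m)) * u E n) =
      (if n mod int p = int m then cis (of_int (n div int p) * \<phi>) else 0)" if "m < p" for m n
  proof -
    define r where "r = nat (n mod int p)"
    have r: "int r = n mod int p" "r < p"
      using p_pos by (simp_all add: r_def nat_less_iff)
    have "u E n = cis (of_int (n div int p) * \<phi>) * u E (int r)" if "E \<in> X" for E
      using bloch_shift[OF u(1)[OF that], of "int r" "n div int p"] by (simp add: r)
    then have "(\<Sum>E\<in>X. cnj (u E (int m)) * u E n)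
        = cis (of_int (n div int p) * \<phi>) * (\<Sum>E\<in>X. cnj (u E (int m)) * u E (int r))"
      by (simp add: sum_distrib_left mult_ac)
    also have "(\<Sum>E\<in>X. cnj (u E (int m)) * u E (int r)) = (if m = r then 1 else 0)"
      using complex_orthonormal_imp_complete[of "{..<p}" X "\<lambda>E n. u E (int n)" m r] X on that r by simp
    finally show ?thesis by (simp add: r(1)[symmetric])
  qed
  have "complex_of_real (\<Sum>E\<in>X. E ^ k) = (\<Sum>E\<in>X. of_real E ^ k * (\<Sum>m<p. u E (int m) * cnj (u E (int m))))"
    using u(2) by simp
  also have "\<dots> = (\<Sum>m<p. \<Sum>E\<in>X. cnj (u E (int m)) * (of_real E ^ k * u E (int m)))"
    by (subst sum.swap) (simp add: sum_distrib_left mult_ac)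
  also have "\<dots> = (\<Sum>m<p. \<Sum>E\<in>X. cnj (u E (int m)) *
      (\<Sum>n\<in>{int m - int k..int m + int k}. of_real (jac_pow a b k (int m) n) * u E n))"
  proof (intro sum.cong refl)
    fix m E assume "E \<in> X"
    have "of_real E ^ k * u E (int m) = (\<Sum>n\<in>{int m - int k..int m + int k}. of_real (jac_pow a b k (int m) n) * u E n)"
      by (rule jac_pow_eigenvector[symmetric]) (use u(1)[OF \<open>E \<in> X\<close>] in \<open>auto simp: bloch_def\<close>)
    then show "cnj (u E (int m)) * (of_real E ^ k * u E (int m)) = cnj (u E (int m)) *
      (\<Sum>n\<in>{int m - int k..int m + int k}. of_real (jac_pow a b k (int m) n) * u E n)" by simp
  qed
  also have "\<dots> = (\<Sum>m<p. \<Sum>n\<in>{int m - int k..int m + int k}. of_real (jac_pow a b k (int m) n) *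
      (\<Sum>E\<in>X. cnj (u E (int m)) * u E n))"
    unfolding sum_distrib_left by (subst (2) sum.swap) (simp add: mult_ac)
  also have "\<dots> = (\<Sum>m<p. \<Sum>n\<in>{int m - int k..int m + int k}. of_real (jac_pow a b k (int m) n) *
      (if n mod int p = int m then cis (of_int (n div int p) * \<phi>) else 0))"
    by (intro sum.cong refl) (simp only: complete lessThan_iff)
  finally have "Re (complex_of_real (\<Sum>E\<in>X. E ^ k)) = Re \<dots>" by simp
  moreover have "Re (of_real y * (if P then cis x else 0)) = y * (if P then cos x else 0)" for P x y by simp
  ultimately show ?thesis unfolding X_def by (simp only: Re_complex_of_real Re_sum)
qed

lemma has_integral_cos_int:
  "((\<lambda>x. cos (of_int i * x)) has_integral (if i = 0 then pi else 0)) {0..pi}"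
proof (cases "i = 0")
  case True
  then show ?thesis using has_integral_const_real[of "1 :: real" 0 pi] by simp
next
  case False
  have "((\<lambda>x. cos (of_int i * x)) has_integral sin (of_int i * pi) / of_int i - sin (of_int i * 0) / of_int i) {0..pi}"
    using False by (intro fundamental_theorem_of_calculus)
      (auto intro!: derivative_eq_intros simp flip: has_real_derivative_iff_has_vector_derivative)
  then show ?thesis using False by (simp add: mult.commute)
qed

lemma has_integral_power_sum:
  "((\<lambda>\<phi>. \<Sum>E | discr p a b E = 2 * cos \<phi>. E ^ k) has_integral
    pi * (\<Sum>m<p. jac_pow a b k (int m) (int m))) {0..pi}"
proof (rule has_integral_spike_finite[where S = "{0, pi}"])
  have t: "((\<lambda>\<phi>. jac_pow a b k (int m) n * (if n mod int p = int m then cos (of_int (n div int p) * \<phi>) else 0))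
      has_integral (if n = int m then jac_pow a b k (int m) (int m) * pi else 0)) {0..pi}"
    if "m < p" for m n
  proof (cases "n mod int p = int m")
    case True
    have "n div int p = 0 \<longleftrightarrow> n = int m"
      using True that p_pos by (metis div_pos_pos_trivial mod_pos_pos_trivial of_nat_0_le_iff of_nat_less_iff mult_zero_right add_0 mult_div_mod_eq)
    then show ?thesis
      using has_integral_mult_right[OF has_integral_cos_int[of "n div int p"], of "jac_pow a b k (int m) n"] True
      by (auto split: if_splits)
  next
    case False
    then have "n \<noteq> int m" using that by auto
    then show ?thesis using False by simp
  qed
  have "((\<lambda>\<phi>. \<Sum>m<p. \<Sum>n\<in>{int m - int k..int m + int k}. jac_pow a b k (int m) n *
      (if n mod int p = int m then cos (of_int (n div int p) * \<phi>) else 0)) has_integral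
      (\<Sum>m<p. \<Sum>n\<in>{int m - int k..int m + int k}. if n = int m then jac_pow a b k (int m) (int m) * pi else 0)) {0..pi}"
    by (intro has_integral_sum t) auto
  then show "((\<lambda>\<phi>. \<Sum>m<p. \<Sum>n\<in>{int m - int k..int m + int k}. jac_pow a b k (int m) n *
      (if n mod int p = int m then cos (of_int (n div int p) * \<phi>) else 0)) has_integral
      pi * (\<Sum>m<p. jac_pow a b k (int m) (int m))) {0..pi}"
    by (simp add: sum_distrib_left mult.commute)
qed (use power_sum_discr_roots in auto)

end

section \<open>Bands and inverse branches\<close>

lemma inj_on_continuous_imp_less:
  fixes f :: "real \<Rightarrow> real"
  assumes f: "continuous_on {l..r} f" "inj_on f {l..r}" "f l < f r"
    and xy: "l \<le> x" "x < y" "y \<le> r"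
  shows "f x < f y"
proof -
  have sub: "continuous_on {x..r} f" "inj_on f {x..r}"
    using xy by (auto intro: continuous_on_subset[OF f(1)] inj_on_subset[OF f(2)])
  have xr: "f x < f r"
  proof (cases "x = l")
    case False
    then have "l < x" "x < r" using xy by auto
    from continuous_inj_imp_mono[OF this f(1,2)] show ?thesis using f(3) by linarith
  qed (use f(3) in simp)
  show ?thesis
  proof (cases "y = r")
    case False
    then have "y < r" using xy by auto
    from continuous_inj_imp_mono[OF xy(2) this sub] show ?thesis using xr by linarith
  qed (use xr in simp)
qed

text \<open>The points of \<open>{x..e}\<close> with |f| at least c form a nonempty compact set,
  which has a largest element.\<close>

lemma last_point_above:
  fixes f :: "real \<Rightarrow> real"
  assumes "continuous_on UNIV f" "x \<le> e" "c \<le> \<bar>f x\<bar>" "\<bar>f e\<bar> < c"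
  obtains l where "l < e" "c \<le> \<bar>f l\<bar>" "\<And>y. l < y \<Longrightarrow> y \<le> e \<Longrightarrow> \<bar>f y\<bar> < c"
proof -
  define S where "S = {x..e} \<inter> {y. c \<le> \<bar>f y\<bar>}"
  have "closed {y. c \<le> \<bar>f y\<bar>}"
    by (intro closed_Collect_le continuous_intros assms)
  then have "compact S" unfolding S_def by (intro compact_Int_closed) auto
  moreover have "x \<in> S" using assms by (auto simp: S_def)
  ultimately obtain l where l: "l \<in> S" "\<And>y. y \<in> S \<Longrightarrow> y \<le> l"
    using compact_attains_sup[of S] by auto
  have "\<bar>f y\<bar> < c" if "l < y" "y \<le> e" for y
    using l(2)[of y] l(1) that by (fastforce simp: S_def)
  moreover have "l \<noteq> e" using l(1) assms by (auto simp: S_def)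
  ultimately show ?thesis using that[of l] l(1) by (auto simp: S_def)
qed

lemma first_point_above:
  fixes f :: "real \<Rightarrow> real"
  assumes "continuous_on UNIV f" "e \<le> x" "c \<le> \<bar>f x\<bar>" "\<bar>f e\<bar> < c"
  obtains r where "e < r" "c \<le> \<bar>f r\<bar>" "\<And>y. e \<le> y \<Longrightarrow> y < r \<Longrightarrow> \<bar>f y\<bar> < c"
proof -
  have "continuous_on UNIV (\<lambda>y. f (- y))"
    by (intro continuous_on_compose2[OF assms(1)] continuous_intros) auto
  then obtain l where l: "l < - e" "c \<le> \<bar>f (- l)\<bar>" "\<And>y. l < y \<Longrightarrow> y \<le> - e \<Longrightarrow> \<bar>f (- y)\<bar> < c"
    using assms by (elim last_point_above[of "\<lambda>y. f (- y)" "- x" "- e" c]) auto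
  show ?thesis
  proof (rule that[of "- l"])
    show "\<bar>f y\<bar> < c" if "e \<le> y" "y < - l" for y using l(3)[of "- y"] that by simp
  qed (use l in auto)
qed

text \<open>The measure is the image, under (e, \<phi>) going to h e \<phi>, of the product of c
  times counting measure on \<open>Z\<close> with Lebesgue measure on [0, pi]; Fubini gives the
  formula. Boundedness of f along the curves provides integrability and covers both indicators and
  powers.\<close>

lemma finite_mixture_measure:
  fixes h :: "'e \<Rightarrow> real \<Rightarrow> real" and c :: real
  assumes Z: "finite Z" and c: "c \<ge> 0" and h: "\<And>e. e \<in> Z \<Longrightarrow> continuous_on UNIV (h e)"
  shows "\<exists>\<mu> :: real measure. sets \<mu> = sets borel \<and> finite_measure \<mu> \<and>
    (\<forall>f B. f \<in> borel_measurable borel \<longrightarrow> (\<forall>e\<in>Z. \<forall>\<phi>. \<bar>f (h e \<phi>)\<bar> \<le> B) \<longrightarrow>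
      integral\<^sup>L \<mu> f = c * (\<Sum>e\<in>Z. LINT \<phi>:{0..pi}|lborel. f (h e \<phi>)))"
proof -
  define M1 where "M1 = point_measure Z (\<lambda>_. ennreal c)"
  define M2 where "M2 = restrict_space lborel {0..pi}"
  define M where "M = M1 \<Otimes>\<^sub>M M2"
  define H where "H = (\<lambda>(e, \<phi>). h e \<phi>)"
  have fin1: "finite_measure M1"
    using Z by (intro finite_measureI) (simp add: M1_def space_point_measure emeasure_point_measure_finite ennreal_mult_eq_top_iff)
  have fin2: "finite_measure M2"
    by (intro finite_measureI) (simp add: M2_def space_restrict_space emeasure_restrict_space)
  interpret M1: finite_measure M1 by fact
  interpret M2: finite_measure M2 by fact
  interpret P: pair_sigma_finite M1 M2 ..
  interpret M: finite_measure M
    unfolding M_def by (rule finite_measure_pair_measure[OF fin2 fin1])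
  have "H \<in> borel_measurable (count_space Z \<Otimes>\<^sub>M M2)"
  proof (rule measurable_pair_measure_countable1)
    show "(\<lambda>y. H (e, y)) \<in> borel_measurable M2" if "e \<in> Z" for e
      unfolding M2_def H_def using borel_measurable_continuous_onI[OF h[OF that]]
      by (simp add: measurable_restrict_space1)
  qed (use Z in \<open>auto intro: countable_finite\<close>)
  then have H[measurable]: "H \<in> borel_measurable M"
    unfolding M_def M1_def
    by (subst measurable_cong_sets[OF sets_pair_measure_cong[OF sets_point_measure_count_space refl] refl])
  have sp: "space M = Z \<times> {0..pi}"
    by (simp add: M_def space_pair_measure M1_def M2_def space_point_measure space_restrict_space)
  show ?thesis
  proof (intro exI[of _ "distr M borel H"] conjI allI impI)
    show "finite_measure (distr M borel H)" by (rule M.finite_measure_distr) simp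
    fix f :: "real \<Rightarrow> real" and B
    assume f[measurable]: "f \<in> borel_measurable borel" and B: "\<forall>e\<in>Z. \<forall>\<phi>. \<bar>f (h e \<phi>)\<bar> \<le> B"
    have "integrable M (\<lambda>x. f (H x))"
    proof (rule M.integrable_const_bound)
      show "AE x in M. norm (f (H x)) \<le> B"
        by (rule AE_I2) (auto simp: sp H_def B)
    qed simp
    then have int: "integrable (M1 \<Otimes>\<^sub>M M2) (\<lambda>x. f (H x))" by (simp add: M_def)
    have "integral\<^sup>L (distr M borel H) f = integral\<^sup>L (M1 \<Otimes>\<^sub>M M2) (\<lambda>x. f (H x))"
      by (subst integral_distr) (simp_all add: M_def[symmetric])
    also have "\<dots> = (\<integral>e. (\<integral>\<phi>. f (H (e, \<phi>)) \<partial>M2) \<partial>M1)"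
      by (rule P.integral_fst'[OF int, symmetric])
    also have "\<dots> = (\<Sum>e\<in>Z. c * (\<integral>\<phi>. f (H (e, \<phi>)) \<partial>M2))"
      unfolding M1_def using Z c by (simp add: lebesgue_integral_point_measure_finite)
    also have "\<dots> = c * (\<Sum>e\<in>Z. LINT \<phi>:{0..pi}|lborel. f (h e \<phi>))"
      by (simp add: sum_distrib_left M2_def integral_restrict_space set_lebesgue_integral_def H_def)
    finally show "integral\<^sup>L (distr M borel H) f = c * (\<Sum>e\<in>Z. LINT \<phi>:{0..pi}|lborel. f (h e \<phi>))" .
  qed simp
qed

section \<open>Bands of the discriminant and the density of states measure\<close>

context jacobi_period
begin

lemma continuous_discr: "continuous_on S (discr p a b)"
  using discr_has_derivative by (meson DERIV_isCont continuous_at_imp_continuous_on)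

text \<open>Rolle would give a zero of D' at a point where |D| < 2.\<close>

lemma discr_no_repeat:
  assumes "x < y" "discr p a b x = discr p a b y" "\<And>t. x < t \<Longrightarrow> t < y \<Longrightarrow> \<bar>discr p a b t\<bar> < 2"
  shows False
proof -
  define D' where "D' = (\<lambda>E. \<Sum>j=1..p. - Phi p a b E j $ 1 $ 2)"
  have D': "(discr p a b has_real_derivative D' t) (at t)" for t
    unfolding D'_def by (rule discr_has_derivative)
  have "\<exists>t. x < t \<and> t < y \<and> (*) (D' t) = (\<lambda>v. 0)"
    by (rule Rolle_deriv[OF assms(1,2) continuous_discr]) (rule D'[unfolded has_field_derivative_def])
  then obtain t where t: "x < t" "t < y" "(*) (D' t) = (\<lambda>v. 0)" by blast
  have "D' t = 0" using fun_cong[OF t(3), of 1] by simp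
  moreover have "D' t \<noteq> 0"
    by (rule discr_derivative_nonzero[OF assms(3)[OF t(1,2)] D'])
  ultimately show False by blast
qed

lemma discr_large:
  obtains B where "B > 0" "\<And>x. B \<le> \<bar>x\<bar> \<Longrightarrow> 2 < \<bar>discr p a b x\<bar>"
proof -
  obtain c q where cq: "discr_poly = pCons c q" by (cases discr_poly)
  have "q \<noteq> 0" using degree_discr_poly p_pos by (auto simp: cq)
  from poly_infinity[OF this, of 3 c] obtain r where r: "\<And>z. r \<le> norm z \<Longrightarrow> 3 \<le> norm (poly discr_poly z)"
    by (auto simp: cq)
  show ?thesis
  proof (rule that[of "max r 1"])
    fix x :: real assume "max r 1 \<le> \<bar>x\<bar>"
    then have "3 \<le> norm (poly discr_poly (of_real x))" by (intro r) simp
    then show "2 < \<bar>discr p a b x\<bar>" by (simp add: poly_discr_poly_of_real)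
  qed simp
qed

text \<open>The point e is a label; zeros of D will be used. At the ends only |D| at least 2 with
  opposite signs is asked for, which is what the intermediate value theorem consumes.\<close>

definition band :: "real \<Rightarrow> real \<Rightarrow> real \<Rightarrow> bool" where
  "band e l r \<longleftrightarrow> l < e \<and> e < r \<and> (\<forall>x. l < x \<longrightarrow> x < r \<longrightarrow> \<bar>discr p a b x\<bar> < 2) \<and> inj_on (discr p a b) {l..r} \<and>
    (discr p a b l \<le> -2 \<and> 2 \<le> discr p a b r \<or> discr p a b r \<le> -2 \<and> 2 \<le> discr p a b l)"

text \<open>From e one moves to the nearest points on both sides with |D| at least 2, which exist
  because D is large far out. D is injective in between by Rolle, and as D(e) = 0 lies strictly
  between the end values, these have opposite signs.\<close>

lemma band_exists:
  assumes e: "discr p a b e = 0"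
  shows "\<exists>l r. band e l r"
proof -
  obtain B where B: "B > 0" "\<And>x. B \<le> \<bar>x\<bar> \<Longrightarrow> 2 < \<bar>discr p a b x\<bar>" using discr_large by blast
  have "\<not> B \<le> \<bar>e\<bar>" using B(2)[of e] e by auto
  then have eB: "- B \<le> e" "e \<le> B" by auto
  have ends: "2 \<le> \<bar>discr p a b (- B)\<bar>" "2 \<le> \<bar>discr p a b B\<bar>"
    using B(2)[of B] B(2)[of "- B"] B(1) by auto
  have e2: "\<bar>discr p a b e\<bar> < 2" using e by simp
  obtain l where l: "l < e" "2 \<le> \<bar>discr p a b l\<bar>" "\<And>y. l < y \<Longrightarrow> y \<le> e \<Longrightarrow> \<bar>discr p a b y\<bar> < 2"
    using last_point_above[OF continuous_discr eB(1) ends(1) e2] by blast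
  obtain r where r: "e < r" "2 \<le> \<bar>discr p a b r\<bar>" "\<And>y. e \<le> y \<Longrightarrow> y < r \<Longrightarrow> \<bar>discr p a b y\<bar> < 2"
    using first_point_above[OF continuous_discr eB(2) ends(2) e2] by blast
  have small: "\<bar>discr p a b x\<bar> < 2" if "l < x" "x < r" for x
    using l(3)[of x] r(3)[of x] that by linarith
  have inj: "inj_on (discr p a b) {l..r}"
    by (rule linorder_inj_onI) (use small in \<open>auto intro: discr_no_repeat\<close>)
  have "discr p a b l < discr p a b e \<and> discr p a b e < discr p a b r \<or>
        discr p a b r < discr p a b e \<and> discr p a b e < discr p a b l"
    by (rule continuous_inj_imp_mono[OF l(1) r(1) continuous_discr inj])
  then have "discr p a b l \<le> -2 \<and> 2 \<le> discr p a b r \<or> discr p a b r \<le> -2 \<and> 2 \<le> discr p a b l"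
    using l(2) r(2) e by linarith
  then show ?thesis
    unfolding band_def using l(1) r(1) small inj by blast
qed

text \<open>Overlapping bands would give |D| < 2 all the way from e to e', against Rolle. Equality r
  = l' is possible: it is a closed gap.\<close>

lemma bands_disjoint:
  assumes "band e l r" "band e' l' r'" "e < e'" "discr p a b e = discr p a b e'"
  shows "r \<le> l'"
proof (rule ccontr)
  assume "\<not> r \<le> l'"
  then have "\<bar>discr p a b t\<bar> < 2" if "e < t" "t < e'" for t
    using assms(1,2) that unfolding band_def by (cases "t < r") auto
  then show False using discr_no_repeat assms(3,4) by blast
qed

definition branch :: "real \<Rightarrow> real \<Rightarrow> real \<Rightarrow> real" where
  "branch l r \<phi> = the_inv_into {l..r} (discr p a b) (2 * cos \<phi>)"

lemma branch:
  assumes band: "band e l r"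
  shows branch_in: "branch l r \<phi> \<in> {l..r}"
    and discr_branch: "discr p a b (branch l r \<phi>) = 2 * cos \<phi>"
    and continuous_branch: "continuous_on UNIV (branch l r)"
proof -
  note b = band[unfolded band_def]
  have onto: "2 * cos \<phi> \<in> discr p a b ` {l..r}" for \<phi>
  proof -
    have "- 2 \<le> 2 * cos \<phi>" "2 * cos \<phi> \<le> 2" using cos_ge_minus_one[of \<phi>] cos_le_one[of \<phi>] by linarith+
    moreover have "l \<le> r" using b by auto
    moreover have "discr p a b l \<le> -2 \<and> 2 \<le> discr p a b r \<or> discr p a b r \<le> -2 \<and> 2 \<le> discr p a b l"
      using b by blast
    ultimately have "\<exists>x\<ge>l. x \<le> r \<and> discr p a b x = 2 * cos \<phi>"
      using IVT'[OF _ _ _ continuous_discr, of l "2 * cos \<phi>" r] IVT2'[OF _ _ _ continuous_discr, of r "2 * cos \<phi>" l]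
      by (meson order_trans)
    then show ?thesis by force
  qed
  have inj: "inj_on (discr p a b) {l..r}" using b by blast
  show "branch l r \<phi> \<in> {l..r}" unfolding branch_def
    by (rule the_inv_into_into[OF inj onto]) simp
  show "discr p a b (branch l r \<phi>) = 2 * cos \<phi>" unfolding branch_def
    by (rule f_the_inv_into_f[OF inj onto])
  have "continuous_on (discr p a b ` {l..r}) (the_inv_into {l..r} (discr p a b))"
    by (rule continuous_on_inv[OF continuous_discr compact_Icc]) (simp add: the_inv_into_f_f[OF inj])
  then show "continuous_on UNIV (branch l r)"
    unfolding branch_def
  proof (rule continuous_on_compose2)
    show "range (\<lambda>\<phi>. 2 * cos \<phi>) \<subseteq> discr p a b ` {l..r}" using onto by blast
  qed (intro continuous_intros)
qed

text \<open>Cosine decreases on [0, pi], so the set is [arccos(D/2), pi] if D increases on the band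
  (s = -1, c = pi) and [0, arccos(D/2)] if D decreases (s = 1, c = 0). The statement forgets which
  case holds.\<close>

lemma measure_branch_le:
  assumes band: "band e l r"
  shows "\<exists>s c. \<bar>s\<bar> = 1 \<and> (\<forall>x. l < x \<longrightarrow> x < r \<longrightarrow>
    measure lborel {\<phi> \<in> {0..pi}. branch l r \<phi> \<le> x} = c + s * arccos (discr p a b x / 2))"
proof -
  note b = band[unfolded band_def]
  have cos_le: "2 * cos \<phi> \<le> discr p a b x \<longleftrightarrow> arccos (discr p a b x / 2) \<le> \<phi>"
    and cos_ge: "discr p a b x \<le> 2 * cos \<phi> \<longleftrightarrow> \<phi> \<le> arccos (discr p a b x / 2)"
    and arc: "0 \<le> arccos (discr p a b x / 2)" "arccos (discr p a b x / 2) \<le> pi"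
    if "0 \<le> \<phi>" "\<phi> \<le> pi" "l < x" "x < r" for \<phi> x
  proof -
    have x: "\<bar>discr p a b x\<bar> < 2" using b that by blast
    show a: "0 \<le> arccos (discr p a b x / 2)" "arccos (discr p a b x / 2) \<le> pi"
      using x by (auto intro!: arccos_lbound arccos_ubound)
    have "cos (arccos (discr p a b x / 2)) = discr p a b x / 2"
      using x by (intro cos_arccos) auto
    then show "2 * cos \<phi> \<le> discr p a b x \<longleftrightarrow> arccos (discr p a b x / 2) \<le> \<phi>"
      "discr p a b x \<le> 2 * cos \<phi> \<longleftrightarrow> \<phi> \<le> arccos (discr p a b x / 2)"
      unfolding cos_mono_le_eq[OF that(1,2) a, symmetric] cos_mono_le_eq[OF a that(1,2), symmetric] by auto
  qed
  show ?thesis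
  proof (cases "discr p a b l < discr p a b r")
    case True
    have less: "discr p a b y < discr p a b x" if "l \<le> y" "y < x" "x \<le> r" for x y
      using inj_on_continuous_imp_less[OF continuous_discr _ True that] b by blast
    have le: "y \<le> x \<longleftrightarrow> discr p a b y \<le> discr p a b x" if "l \<le> y" "y \<le> r" "l \<le> x" "x \<le> r" for x y
    proof
      show "discr p a b y \<le> discr p a b x" if "y \<le> x"
        using less[of y x] that \<open>l \<le> y\<close> \<open>x \<le> r\<close> by (cases "y = x") auto
      show "y \<le> x" if "discr p a b y \<le> discr p a b x"
      proof (rule ccontr)
        assume "\<not> y \<le> x"
        then have "discr p a b x < discr p a b y" using \<open>l \<le> x\<close> \<open>y \<le> r\<close> by (intro less) auto
        then show False using that by simp
      qed
    qed
    have "measure lborel {\<phi> \<in> {0..pi}. branch l r \<phi> \<le> x} = pi + (-1) * arccos (discr p a b x / 2)"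
      if x: "l < x" "x < r" for x
    proof -
      have "branch l r \<phi> \<le> x \<longleftrightarrow> arccos (discr p a b x / 2) \<le> \<phi>" if "0 \<le> \<phi>" "\<phi> \<le> pi" for \<phi>
        using branch_in[OF band, of \<phi>] le[of "branch l r \<phi>" x] cos_le[OF that x] x
        by (simp add: discr_branch[OF band])
      moreover have "0 \<le> arccos (discr p a b x / 2)"
        using arc[OF _ _ x, of 0] by simp
      ultimately have "{\<phi> \<in> {0..pi}. branch l r \<phi> \<le> x} = {arccos (discr p a b x / 2)..pi}"
        unfolding set_eq_iff mem_Collect_eq atLeastAtMost_iff by (metis order_trans)
      then show ?thesis using arc[OF _ _ x, of 0] by simp
    qed
    then show ?thesis by (intro exI[of _ "-1"] exI[of _ pi]) auto
  next
    case False
    then have F: "- discr p a b l < - discr p a b r" using b by auto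
    have "inj_on (\<lambda>x. - discr p a b x) {l..r}" using b by (auto simp: inj_on_def)
    then have less: "discr p a b x < discr p a b y" if "l \<le> y" "y < x" "x \<le> r" for x y
      using inj_on_continuous_imp_less[OF continuous_on_minus[OF continuous_discr] _ F that] by simp
    have le: "y \<le> x \<longleftrightarrow> discr p a b x \<le> discr p a b y" if "l \<le> y" "y \<le> r" "l \<le> x" "x \<le> r" for x y
    proof
      show "discr p a b x \<le> discr p a b y" if "y \<le> x"
        using less[of y x] that \<open>l \<le> y\<close> \<open>x \<le> r\<close> by (cases "y = x") auto
      show "y \<le> x" if "discr p a b x \<le> discr p a b y"
      proof (rule ccontr)
        assume "\<not> y \<le> x"
        then have "discr p a b y < discr p a b x" using \<open>l \<le> x\<close> \<open>y \<le> r\<close> by (intro less) auto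
        then show False using that by simp
      qed
    qed
    have "measure lborel {\<phi> \<in> {0..pi}. branch l r \<phi> \<le> x} = 0 + 1 * arccos (discr p a b x / 2)"
      if x: "l < x" "x < r" for x
    proof -
      have "branch l r \<phi> \<le> x \<longleftrightarrow> \<phi> \<le> arccos (discr p a b x / 2)" if "0 \<le> \<phi>" "\<phi> \<le> pi" for \<phi>
        using branch_in[OF band, of \<phi>] le[of "branch l r \<phi>" x] cos_ge[OF that x] x
        by (simp add: discr_branch[OF band])
      moreover have "arccos (discr p a b x / 2) \<le> pi"
        using arc[OF _ _ x, of 0] by simp
      ultimately have "{\<phi> \<in> {0..pi}. branch l r \<phi> \<le> x} = {0..arccos (discr p a b x / 2)}"
        unfolding set_eq_iff mem_Collect_eq atLeastAtMost_iff by (metis order_trans)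
      then show ?thesis using arc[OF _ _ x, of 0] by simp
    qed
    then show ?thesis by (intro exI[of _ "1"] exI[of _ 0]) auto
  qed
qed

text \<open>Values of different branches lie inside disjoint bands, hence differ. There are as many
  branches as zeros of D, namely p, and also p solutions of D = 2 cos \<phi>; counting shows that no
  solution lies outside the bands.\<close>

lemma discr_roots_branch:
  assumes bands: "\<forall>e. discr p a b e = 0 \<longrightarrow> band e (L e) (R e)" and \<phi>: "0 < \<phi>" "\<phi> < pi"
  shows "inj_on (\<lambda>e. branch (L e) (R e) \<phi>) {e. discr p a b e = 0}"
    and "(\<lambda>e. branch (L e) (R e) \<phi>) ` {e. discr p a b e = 0} = {x. discr p a b x = 2 * cos \<phi>}"
proof -
  note band = bands[rule_format]
  have "cos \<phi> < 1" "cos \<phi> > - 1"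
    using cos_monotone_0_pi[of 0 \<phi>] cos_monotone_0_pi[of \<phi> pi] \<phi> by auto
  then have c: "\<bar>2 * cos \<phi>\<bar> < 2" by auto
  have inner: "L e < branch (L e) (R e) \<phi> \<and> branch (L e) (R e) \<phi> < R e" if "discr p a b e = 0" for e
  proof -
    have "\<bar>discr p a b (L e)\<bar> \<ge> 2" "\<bar>discr p a b (R e)\<bar> \<ge> 2"
      using band[OF that] unfolding band_def by auto
    then have "branch (L e) (R e) \<phi> \<noteq> L e" "branch (L e) (R e) \<phi> \<noteq> R e"
      using discr_branch[OF band[OF that], of \<phi>] c by auto
    then show ?thesis using branch_in[OF band[OF that], of \<phi>] by auto
  qed
  show inj: "inj_on (\<lambda>e. branch (L e) (R e) \<phi>) {e. discr p a b e = 0}"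
  proof (rule linorder_inj_onI)
    fix e e' assume e: "e < e'" "e \<in> {e. discr p a b e = 0}" "e' \<in> {e. discr p a b e = 0}"
    then have "R e \<le> L e'"
      by (intro bands_disjoint[OF band band]) auto
    then show "branch (L e) (R e) \<phi> \<noteq> branch (L e') (R e') \<phi>"
      using inner[of e] inner[of e'] e by auto
  qed auto
  show "(\<lambda>e. branch (L e) (R e) \<phi>) ` {e. discr p a b e = 0} = {x. discr p a b x = 2 * cos \<phi>}"
  proof (rule card_subset_eq)
    show "finite {x. discr p a b x = 2 * cos \<phi>}" by (rule card_discr_eq(2)[OF c])
    show "(\<lambda>e. branch (L e) (R e) \<phi>) ` {e. discr p a b e = 0} \<subseteq> {x. discr p a b x = 2 * cos \<phi>}"
      using discr_branch[OF band] by auto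
    show "card ((\<lambda>e. branch (L e) (R e) \<phi>) ` {e. discr p a b e = 0}) = card {x. discr p a b x = 2 * cos \<phi>}"
      using card_image[OF inj] card_discr_eq(1)[OF c] card_discr_eq(1)[of 0] by simp
  qed
qed

lemma integral_branch_powers:
  assumes bands: "\<forall>e. discr p a b e = 0 \<longrightarrow> band e (L e) (R e)"
  shows "(\<Sum>e | discr p a b e = 0. LINT \<phi>:{0..pi}|lborel. branch (L e) (R e) \<phi> ^ k)
    = pi * (\<Sum>m<p. jac_pow a b k (int m) (int m))"
proof -
  note band = bands[rule_format]
  define Z where "Z = {e. discr p a b e = 0}"
  have Z: "finite Z" unfolding Z_def by (rule card_discr_eq(2)) simp
  have cont: "continuous_on {0..pi} (\<lambda>\<phi>. branch (L e) (R e) \<phi> ^ k)" if "e \<in> Z" for e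
    using continuous_on_subset[OF continuous_branch[OF band]] that
    by (intro continuous_on_power) (auto simp: Z_def)
  have "((\<lambda>\<phi>. \<Sum>e\<in>Z. branch (L e) (R e) \<phi> ^ k) has_integral pi * (\<Sum>m<p. jac_pow a b k (int m) (int m))) {0..pi}"
  proof (rule has_integral_spike_finite[OF _ _ has_integral_power_sum])
    fix \<phi> assume "\<phi> \<in> {0..pi} - {0, pi}"
    then have \<phi>: "0 < \<phi>" "\<phi> < pi" by auto
    note br = discr_roots_branch[OF bands \<phi>, folded Z_def]
    show "(\<Sum>e\<in>Z. branch (L e) (R e) \<phi> ^ k) = (\<Sum>E | discr p a b E = 2 * cos \<phi>. E ^ k)"
      by (subst br(2)[symmetric], subst sum.reindex[OF br(1)]) simp
  qed simp
  then have "pi * (\<Sum>m<p. jac_pow a b k (int m) (int m)) = integral {0..pi} (\<lambda>\<phi>. \<Sum>e\<in>Z. branch (L e) (R e) \<phi> ^ k)"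
    by (rule integral_unique[symmetric])
  also have "\<dots> = (\<Sum>e\<in>Z. integral {0..pi} (\<lambda>\<phi>. branch (L e) (R e) \<phi> ^ k))"
    using Z cont by (intro Henstock_Kurzweil_Integration.integral_sum integrable_continuous_interval) auto
  also have "\<dots> = (\<Sum>e\<in>Z. LINT \<phi>:{0..pi}|lborel. branch (L e) (R e) \<phi> ^ k)"
    using cont by (intro sum.cong refl set_borel_integral_eq_integral(2)[symmetric] borel_integrable_atLeastAtMost') auto
  finally show ?thesis unfolding Z_def by simp
qed

text \<open>Discharges the definite description: the mixture of the branches has the prescribed
  moments and compact support, and any competitor agrees with it by its moments. Then the measure of
  \<open>{..x}\<close> is read off.\<close>

lemma ids_eq_branch:
  assumes bands: "\<forall>e. discr p a b e = 0 \<longrightarrow> band e (L e) (R e)"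
  shows "ids p a b x = 1 / (pi * real p) *
    (\<Sum>e | discr p a b e = 0. measure lborel {\<phi> \<in> {0..pi}. branch (L e) (R e) \<phi> \<le> x})"
proof -
  note band = bands[rule_format]
  define Z where "Z = {e. discr p a b e = 0}"
  define c where "c = 1 / (pi * real p)"
  define h where "h e = branch (L e) (R e)" for e
  have bandZ: "band e (L e) (R e)" if "e \<in> Z" for e using band that by (simp add: Z_def)
  have Z: "finite Z" unfolding Z_def by (rule card_discr_eq(2)) simp
  have c0: "c \<ge> 0" by (simp add: c_def)
  have cont: "continuous_on UNIV (h e)" if "e \<in> Z" for e
    unfolding h_def by (rule continuous_branch[OF bandZ[OF that]])
  obtain \<mu> :: "real measure" where \<mu>: "sets \<mu> = sets borel" "finite_measure \<mu>"
    and int: "\<And>f B. f \<in> borel_measurable borel \<Longrightarrow> \<forall>e\<in>Z. \<forall>\<phi>. \<bar>f (h e \<phi>)\<bar> \<le> B \<Longrightarrow>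
      integral\<^sup>L \<mu> f = c * (\<Sum>e\<in>Z. LINT \<phi>:{0..pi}|lborel. f (h e \<phi>))"
    using finite_mixture_measure[of Z c h, OF Z c0 cont] by blast
  interpret finite_measure \<mu> by fact
  have sp: "space \<mu> = UNIV" using sets_eq_imp_space_eq[OF \<mu>(1)] by simp
  obtain B where B: "B > 0" "\<And>x. B \<le> \<bar>x\<bar> \<Longrightarrow> 2 < \<bar>discr p a b x\<bar>" using discr_large by blast
  \<comment> \<open>Beyond B one has |D| > 2, whereas D equals 2 cos \<phi> along a branch; so the
    branches stay in [-B, B], which bounds the support.\<close>
  have hB: "\<bar>h e \<phi>\<bar> \<le> B" if "e \<in> Z" for e \<phi>
  proof (rule ccontr)
    assume "\<not> \<bar>h e \<phi>\<bar> \<le> B"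
    then have "2 < \<bar>discr p a b (h e \<phi>)\<bar>" by (intro B(2)) simp
    then have "2 < \<bar>2 * cos \<phi>\<bar>" using discr_branch[OF bandZ[OF that], of \<phi>] by (simp add: h_def)
    then show False using abs_cos_le_one[of \<phi>] by (simp add: abs_mult)
  qed
  have meas: "measure \<mu> A = c * (\<Sum>e\<in>Z. LINT \<phi>:{0..pi}|lborel. indicator A (h e \<phi>))" if "A \<in> sets borel" for A
    using int[of "indicator A" 1] that by (simp add: sp)
  have supp: "emeasure \<mu> {x. B < \<bar>x\<bar>} = 0"
  proof -
    have "indicator {x. B < \<bar>x\<bar>} (h e \<phi>) = (0 :: real)" if "e \<in> Z" for e \<phi>
      using hB[OF that, of \<phi>] by simp
    then have "measure \<mu> {x. B < \<bar>x\<bar>} = 0"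
      by (subst meas) simp_all
    then show ?thesis by (simp add: emeasure_eq_measure)
  qed
  have moments: "integral\<^sup>L \<mu> (\<lambda>x. x ^ k) = (1 / real p) * (\<Sum>n<p. jac_pow a b k (int n) (int n))" for k
  proof -
    have "integral\<^sup>L \<mu> (\<lambda>x. x ^ k) = c * (\<Sum>e\<in>Z. LINT \<phi>:{0..pi}|lborel. h e \<phi> ^ k)"
      using hB by (intro int[of _ "B ^ k"]) (simp_all add: power_abs power_mono)
    also have "(\<Sum>e\<in>Z. LINT \<phi>:{0..pi}|lborel. h e \<phi> ^ k) = pi * (\<Sum>n<p. jac_pow a b k (int n) (int n))"
      unfolding Z_def h_def by (rule integral_branch_powers[OF bands])
    finally show ?thesis by (simp add: c_def)
  qed
  have "dos_measure p a b = \<mu>"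
    unfolding dos_measure_def
  proof (rule the_equality)
    show "sets \<mu> = sets borel \<and> finite_measure \<mu> \<and> (\<exists>R. emeasure \<mu> {x. R < \<bar>x\<bar>} = 0) \<and>
      (\<forall>k. integral\<^sup>L \<mu> (\<lambda>x. x ^ k) = 1 / real p * (\<Sum>n<p. jac_pow a b k (int n) (int n)))"
      using \<mu> supp moments by blast
    fix \<nu> :: "real measure"
    assume \<nu>: "sets \<nu> = sets borel \<and> finite_measure \<nu> \<and> (\<exists>R. emeasure \<nu> {x. R < \<bar>x\<bar>} = 0) \<and>
      (\<forall>k. integral\<^sup>L \<nu> (\<lambda>x. x ^ k) = 1 / real p * (\<Sum>n<p. jac_pow a b k (int n) (int n)))"
    then obtain S where S: "emeasure \<nu> {x. S < \<bar>x\<bar>} = 0" by blast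
    show "\<nu> = \<mu>"
    proof (rule measure_eq_of_moments_eq[OF _ _ S \<mu> supp])
      show "integral\<^sup>L \<nu> (\<lambda>x. x ^ k) = integral\<^sup>L \<mu> (\<lambda>x. x ^ k)" for k
        using \<nu> moments by simp
    qed (use \<nu> in simp_all)
  qed
  then have "ids p a b x = c * (\<Sum>e\<in>Z. LINT \<phi>:{0..pi}|lborel. indicator {..x} (h e \<phi>))"
    unfolding ids_def by (simp add: meas)
  also have "(\<Sum>e\<in>Z. LINT \<phi>:{0..pi}|lborel. indicator {..x} (h e \<phi>))
      = (\<Sum>e\<in>Z. measure lborel {\<phi> \<in> {0..pi}. h e \<phi> \<le> x})"
  proof (rule sum.cong[OF refl])
    fix e assume "e \<in> Z"
    have "(LINT \<phi>:{0..pi}|lborel. indicator {..x} (h e \<phi>))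
        = (\<integral>\<phi>. indicator {\<phi> \<in> {0..pi}. h e \<phi> \<le> x} \<phi> \<partial>lborel :: real)"
      unfolding set_lebesgue_integral_def
      by (rule Bochner_Integration.integral_cong) (auto split: split_indicator)
    also have "\<dots> = measure lborel {\<phi> \<in> {0..pi}. h e \<phi> \<le> x}" by simp
    finally show "(LINT \<phi>:{0..pi}|lborel. indicator {..x} (h e \<phi>)) = measure lborel {\<phi> \<in> {0..pi}. h e \<phi> \<le> x}" .
  qed
  finally show ?thesis unfolding Z_def c_def h_def .
qed

text \<open>Needed to fix the sign of dk/dE, which \<open>measure_branch_le\<close> leaves
  open.\<close>

lemma mono_ids: "mono (ids p a b)"
proof -
  obtain L R where bands: "\<forall>e. discr p a b e = 0 \<longrightarrow> band e (L e) (R e)"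
    using band_exists by metis
  note band = bands[rule_format]
  show ?thesis
  proof (rule monoI)
    fix x y :: real assume "x \<le> y"
    have "measure lborel {\<phi> \<in> {0..pi}. branch (L e) (R e) \<phi> \<le> x} \<le> measure lborel {\<phi> \<in> {0..pi}. branch (L e) (R e) \<phi> \<le> y}"
      if "discr p a b e = 0" for e
    proof (rule measure_mono_fmeasurable)
      have closed: "closed {\<phi>. branch (L e) (R e) \<phi> \<le> t}" for t
        by (intro closed_Collect_le continuous_branch[OF band[OF that]] continuous_intros)
      have eq: "{\<phi> \<in> {0..pi}. branch (L e) (R e) \<phi> \<le> t} = {0..pi} \<inter> {\<phi>. branch (L e) (R e) \<phi> \<le> t}" for t
        by blast
      show "{\<phi> \<in> {0..pi}. branch (L e) (R e) \<phi> \<le> x} \<in> sets lborel"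
        unfolding eq using closed by simp
      show "{\<phi> \<in> {0..pi}. branch (L e) (R e) \<phi> \<le> y} \<in> fmeasurable lborel"
        unfolding eq by (intro fmeasurable_compact compact_Int_closed closed) simp
    qed (use \<open>x \<le> y\<close> in auto)
    then show "ids p a b x \<le> ids p a b y"
      unfolding ids_eq_branch[OF bands] by (intro mult_left_mono sum_mono) auto
  qed
qed

text \<open>Near E only the branch whose band contains E contributes a varying term; every other
  band lies entirely to the left or to the right and adds a constant.\<close>

lemma ids_has_derivative:
  assumes E: "\<bar>discr p a b E\<bar> < 2" and d: "(discr p a b has_real_derivative d) (at E)"
  shows "(ids p a b has_real_derivative \<bar>d\<bar> / (2 * pi * real p * sqrt (1 - (discr p a b E)\<^sup>2 / 4))) (at E)"
proof -
  obtain L R where bands: "\<forall>e. discr p a b e = 0 \<longrightarrow> band e (L e) (R e)"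
    using band_exists by metis
  note band = bands[rule_format]
  define Z where "Z = {e. discr p a b e = 0}"
  have Z: "finite Z" unfolding Z_def by (rule card_discr_eq(2)) simp
  define F where "F e x = measure lborel {\<phi> \<in> {0..pi}. branch (L e) (R e) \<phi> \<le> x}" for e x
  define \<phi> where "\<phi> = arccos (discr p a b E / 2)"
  have \<phi>: "0 < \<phi>" "\<phi> < pi" "discr p a b E = 2 * cos \<phi>"
    using E arccos_lt_bounded[of "discr p a b E / 2"] by (auto simp: \<phi>_def cos_arccos)
  have "E \<in> {x. discr p a b x = 2 * cos \<phi>}" using \<phi> by simp
  then obtain e0 where e0: "e0 \<in> Z" "E = branch (L e0) (R e0) \<phi>"
    unfolding discr_roots_branch(2)[OF bands \<phi>(1,2), symmetric] Z_def by blast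
  have band0: "band e0 (L e0) (R e0)" using band e0(1) by (simp add: Z_def)
  have "\<bar>discr p a b (L e0)\<bar> \<ge> 2" "\<bar>discr p a b (R e0)\<bar> \<ge> 2"
    using band0 unfolding band_def by auto
  then have "E \<noteq> L e0" "E \<noteq> R e0" using E by auto
  then have E_in: "E \<in> {L e0<..<R e0}"
    using branch_in[OF band0, of \<phi>] e0(2) by auto
  have other: "(F e has_real_derivative 0) (at E)" if e: "e \<in> Z - {e0}" for e
  proof -
    have be: "band e (L e) (R e)" using band e by (simp add: Z_def)
    have De: "discr p a b e = discr p a b e0" using e e0(1) by (simp add: Z_def)
    have "\<exists>c. \<forall>x\<in>{L e0<..<R e0}. F e x = c"
    proof (cases "e < e0")
      case True
      then have "R e \<le> L e0" by (rule bands_disjoint[OF be band0 _ De])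
      then have "branch (L e) (R e) \<phi> \<le> x" if "x \<in> {L e0<..<R e0}" for \<phi> x
        using branch_in[OF be, of \<phi>] that by auto
      then have "F e x = measure lborel {0..pi}" if "x \<in> {L e0<..<R e0}" for x
        using that by (simp add: F_def atLeastAtMost_def Int_def)
      then show ?thesis by blast
    next
      case False
      then have "e0 < e" using e by auto
      then have "R e0 \<le> L e" by (rule bands_disjoint[OF band0 be _ De[symmetric]])
      then have "\<not> branch (L e) (R e) \<phi> \<le> x" if "x \<in> {L e0<..<R e0}" for \<phi> x
        using branch_in[OF be, of \<phi>] that by auto
      then have "F e x = measure lborel {}" if "x \<in> {L e0<..<R e0}" for x
        using that by (simp add: F_def)
      then show ?thesis by blast
    qed
    then obtain c where c: "\<And>x. x \<in> {L e0<..<R e0} \<Longrightarrow> F e x = c" by blast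
    have "((\<lambda>_. c) has_real_derivative 0) (at E)" by simp
    then show ?thesis
    proof (rule has_field_derivative_transform_within_open)
      show "c = F e x" if "x \<in> {L e0<..<R e0}" for x using c[OF that] by simp
    qed (use E_in in auto)
  qed
  define \<omega> where "\<omega> = sqrt (1 - (discr p a b E)\<^sup>2 / 4)"
  obtain s c where s: "\<bar>s\<bar> = 1" and c: "\<And>x. L e0 < x \<Longrightarrow> x < R e0 \<Longrightarrow> F e0 x = c + s * arccos (discr p a b x / 2)"
    using measure_branch_le[OF band0] unfolding F_def by blast
  have "((\<lambda>x. discr p a b x / 2) has_real_derivative d / 2) (at E)"
    by (rule DERIV_cdivide[OF d])
  moreover have "(arccos has_real_derivative inverse (- sqrt (1 - (discr p a b E / 2)\<^sup>2))) (at (discr p a b E / 2))"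
    using E by (intro DERIV_arccos) auto
  ultimately have "((\<lambda>x. arccos (discr p a b x / 2)) has_real_derivative inverse (- sqrt (1 - (discr p a b E / 2)\<^sup>2)) * (d / 2)) (at E)"
    by (rule DERIV_chain2[rotated])
  moreover have "inverse (- sqrt (1 - (discr p a b E / 2)\<^sup>2)) * (d / 2) = - d / (2 * \<omega>)"
    by (simp add: \<omega>_def power_divide field_simps)
  ultimately have "((\<lambda>x. arccos (discr p a b x / 2)) has_real_derivative - d / (2 * \<omega>)) (at E)"
    by (simp only:)
  then have "((\<lambda>x. c + s * arccos (discr p a b x / 2)) has_real_derivative 0 + s * (- d / (2 * \<omega>))) (at E)"
    by (intro DERIV_add DERIV_const DERIV_cmult)
  then have "(F e0 has_real_derivative 0 + s * (- d / (2 * \<omega>))) (at E)"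
  proof (rule has_field_derivative_transform_within_open)
    show "c + s * arccos (discr p a b x / 2) = F e0 x" if "x \<in> {L e0<..<R e0}" for x
      using c[of x] that by simp
  qed (use E_in in auto)
  then have main: "(F e0 has_real_derivative s * (- d / (2 * \<omega>))) (at E)" by simp
  define v where "v = 1 / (pi * real p) * (s * (- d / (2 * \<omega>)))"
  have "((\<lambda>x. \<Sum>e\<in>Z. F e x) has_real_derivative (\<Sum>e\<in>Z. if e = e0 then s * (- d / (2 * \<omega>)) else 0)) (at E)"
  proof (rule DERIV_sum)
    show "(F e has_real_derivative (if e = e0 then s * (- d / (2 * \<omega>)) else 0)) (at E)" if "e \<in> Z" for e
      using main other[of e] that by (cases "e = e0") simp_all
  qed
  then have "((\<lambda>x. 1 / (pi * real p) * (\<Sum>e\<in>Z. F e x)) has_real_derivative v) (at E)"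
    unfolding v_def using Z e0(1) by (intro DERIV_cmult) simp
  moreover have "ids p a b = (\<lambda>x. 1 / (pi * real p) * (\<Sum>e\<in>Z. F e x))"
    unfolding F_def Z_def using ids_eq_branch[OF bands] by blast
  ultimately have ids: "(ids p a b has_real_derivative v) (at E)" by simp
  \<comment> \<open>The derivative is known up to the sign \<open>s\<close>; as k is monotone it
    equals its absolute value.\<close>
  have "v \<ge> 0"
    using mono_on_imp_deriv_nonneg[OF _ ids, of UNIV] mono_ids by simp
  have "\<omega> \<ge> 0" using sqrt_one_minus_pos[OF E] by (simp add: \<omega>_def)
  have "v = \<bar>v\<bar>" using \<open>v \<ge> 0\<close> by simp
  also have "\<dots> = \<bar>d\<bar> / (2 * pi * real p * \<omega>)"
    unfolding v_def using s \<open>\<omega> \<ge> 0\<close> by (simp add: abs_mult mult_ac)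
  finally show ?thesis using ids by (simp add: \<omega>_def)
qed

section \<open>Comparison of the derivative with the Hilbert-Schmidt norms\<close>

lemma abs_le_sup_norm: "\<bar>a n\<bar> \<le> sup_norm a"
  unfolding sup_norm_def
proof (rule cSUP_upper)
  \<comment> \<open>A supremum of reals is meaningful only for a bounded family; periodicity leaves
    finitely many values, and their sum is a convenient bound.\<close>
  have "\<bar>a n\<bar> \<le> (\<Sum>m<p. \<bar>a (int m)\<bar>)" for n
  proof -
    define r where "r = nat (n mod int p)"
    have r: "int r = n mod int p" "r < p" using p_pos by (simp_all add: r_def nat_less_iff)
    have "a n = a (int r)"
    proof (cases "n div int p \<ge> 0")
      case True
      then show ?thesis using a_per_mult[of "int r" "nat (n div int p)"] by (simp add: r)
    next
      case False
      then show ?thesis using a_per_mult[of n "nat (- (n div int p))"]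
        by (simp add: r minus_mult_div_eq_mod)
    qed
    then show ?thesis using r member_le_sum[of r "{..<p}" "\<lambda>m. \<bar>a (int m)\<bar>"] by simp
  qed
  then show "bdd_above (range (\<lambda>n. \<bar>a n\<bar>))" by (intro bdd_aboveI2)
qed simp

text \<open>Both sides are expressed by the same positive numbers \<open>t j\<close>, so the
  inequality and the equality differ only in how the weights 1 + a_j^2 are treated.\<close>

lemma ids_derivative_hs_norm:
  assumes E: "\<bar>discr p a b E\<bar> < 2"
    and M: "\<And>j. j \<in> {1..p} \<Longrightarrow> conj_to_SO2 (M j) (Phi p a b E j)"
  shows "\<exists>t \<omega>. \<omega> > 0 \<and> (\<forall>j\<in>{1..p}. t j > 0) \<and>
    (ids p a b has_real_derivative (\<Sum>j=1..p. t j) / (2 * pi * real p * \<omega>)) (at E) \<and>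
    (\<Sum>j=1..p. hs_norm_sq (M j)) = (\<Sum>j=1..p. (1 + (a (int j))\<^sup>2) * t j) / \<omega>"
proof (rule discr_derivative_hs_norm[OF E])
  fix d t
  define \<omega> where "\<omega> = sqrt (1 - (discr p a b E)\<^sup>2 / 4)"
  assume d: "(discr p a b has_real_derivative d) (at E)" and t: "\<And>j. j \<in> {1..p} \<Longrightarrow> 0 < t j"
    and dt: "\<bar>d\<bar> = (\<Sum>j=1..p. t j)"
    and hs: "\<And>M. (\<And>j. j \<in> {1..p} \<Longrightarrow> conj_to_SO2 (M j) (Phi p a b E j)) \<Longrightarrow>
      (\<Sum>j=1..p. hs_norm_sq (M j)) = (\<Sum>j=1..p. (1 + (a (int j))\<^sup>2) * t j) / sqrt (1 - (discr p a b E)\<^sup>2 / 4)"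
  have \<omega>: "\<omega> > 0" unfolding \<omega>_def by (rule sqrt_one_minus_pos[OF E])
  have hs': "(\<Sum>j=1..p. hs_norm_sq (M j)) = (\<Sum>j=1..p. (1 + (a (int j))\<^sup>2) * t j) / \<omega>"
    unfolding \<omega>_def by (rule hs[OF M])
  show ?thesis
    using \<omega> t ids_has_derivative[OF E d, unfolded dt, folded \<omega>_def] hs' by blast
qed

end

theorem theoremA1:
  shows "(\<exists>C :: real \<Rightarrow> real. (\<forall>\<alpha>. C \<alpha> > 0) \<and>
     (\<forall>p a b E M. periodic_jacobi p a b \<longrightarrow> discr p a b E \<in> {-2<..<2} \<longrightarrow>
        (\<forall>j\<in>{1..p}. conj_to_SO2 (M j) (Phi p a b E j)) \<longrightarrow>
        (\<exists>d. (ids p a b has_real_derivative d) (at E) \<and>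
             d \<ge> C (sup_norm a) / real p * (\<Sum>j=1..p. hs_norm_sq (M j)))))
   \<and> (\<forall>p a b E M a0. periodic_jacobi p a b \<longrightarrow> (\<forall>n. a n = a0) \<longrightarrow>
        discr p a b E \<in> {-2<..<2} \<longrightarrow>
        (\<forall>j\<in>{1..p}. conj_to_SO2 (M j) (Phi p a b E j)) \<longrightarrow>
        (ids p a b has_real_derivative
           (1 / (2 * (1 + a0\<^sup>2) * pi)) / real p * (\<Sum>j=1..p. hs_norm_sq (M j))) (at E))"
proof (intro conjI exI[of _ "\<lambda>\<alpha>. 1 / (2 * (1 + \<alpha>\<^sup>2) * pi)"] allI impI)
  show "0 < 1 / (2 * (1 + \<alpha>\<^sup>2) * pi)" for \<alpha> :: real
    by (intro divide_pos_pos mult_pos_pos add_pos_nonneg) auto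
next
  fix p a b E M
  assume per: "periodic_jacobi p a b" and E: "discr p a b E \<in> {-2<..<2}"
    and M: "\<forall>j\<in>{1..p}. conj_to_SO2 (M j) (Phi p a b E j)"
  interpret jacobi_period p a b by unfold_locales fact
  obtain t \<omega> where \<omega>: "\<omega> > 0" and t: "\<forall>j\<in>{1..p}. t j > 0"
    and d: "(ids p a b has_real_derivative (\<Sum>j=1..p. t j) / (2 * pi * real p * \<omega>)) (at E)"
    and hs: "(\<Sum>j=1..p. hs_norm_sq (M j)) = (\<Sum>j=1..p. (1 + (a (int j))\<^sup>2) * t j) / \<omega>"
    using ids_derivative_hs_norm[of E M] E M by (auto simp: abs_less_iff)
  define K where "K = 1 + (sup_norm a)\<^sup>2"
  have K: "K > 0" by (simp add: K_def add_pos_nonneg)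
  \<comment> \<open>The only inequality of the whole argument; for constant a all weights coincide
    and it becomes an equality.\<close>
  have "(\<Sum>j=1..p. (1 + (a (int j))\<^sup>2) * t j) \<le> (\<Sum>j=1..p. K * t j)"
  proof (intro sum_mono mult_right_mono)
    fix j assume "j \<in> {1..p}"
    then show "0 \<le> t j" using t by (simp add: less_imp_le)
    have "(a (int j))\<^sup>2 \<le> (sup_norm a)\<^sup>2"
      using abs_le_sup_norm[of "int j"] by (intro abs_le_square_iff[THEN iffD1]) linarith
    then show "1 + (a (int j))\<^sup>2 \<le> K" by (simp add: K_def)
  qed
  then have "1 / (2 * K * pi) / real p * (\<Sum>j=1..p. hs_norm_sq (M j)) \<le> 1 / (2 * K * pi) / real p * ((\<Sum>j=1..p. K * t j) / \<omega>)"
    unfolding hs using K \<omega> by (intro mult_left_mono divide_right_mono) auto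
  also have "\<dots> = (\<Sum>j=1..p. t j) / (2 * pi * real p * \<omega>)"
    unfolding sum_distrib_left[symmetric] using K \<omega> p_pos by (simp add: field_simps)
  finally show "\<exists>d. (ids p a b has_real_derivative d) (at E) \<and>
      d \<ge> 1 / (2 * (1 + (sup_norm a)\<^sup>2) * pi) / real p * (\<Sum>j=1..p. hs_norm_sq (M j))"
    using d unfolding K_def by blast
next
  fix p a b E M and a0 :: real
  assume per: "periodic_jacobi p a b" and const: "\<forall>n. a n = a0" and E: "discr p a b E \<in> {-2<..<2}"
    and M: "\<forall>j\<in>{1..p}. conj_to_SO2 (M j) (Phi p a b E j)"
  interpret jacobi_period p a b by unfold_locales fact
  obtain t \<omega> where \<omega>: "\<omega> > 0"
    and d: "(ids p a b has_real_derivative (\<Sum>j=1..p. t j) / (2 * pi * real p * \<omega>)) (at E)"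
    and hs: "(\<Sum>j=1..p. hs_norm_sq (M j)) = (\<Sum>j=1..p. (1 + (a (int j))\<^sup>2) * t j) / \<omega>"
    using ids_derivative_hs_norm[of E M] E M by (auto simp: abs_less_iff)
  define K where "K = 1 + a0\<^sup>2"
  have K: "K > 0" by (simp add: K_def add_pos_nonneg)
  have "(\<Sum>j=1..p. t j) / (2 * pi * real p * \<omega>) = 1 / (2 * K * pi) / real p * (\<Sum>j=1..p. hs_norm_sq (M j))"
    unfolding hs using const K \<omega> p_pos
    by (simp add: K_def[symmetric] sum_distrib_left[symmetric] field_simps)
  then show "(ids p a b has_real_derivative
      1 / (2 * (1 + a0\<^sup>2) * pi) / real p * (\<Sum>j=1..p. hs_norm_sq (M j))) (at E)"
    using d by (simp add: K_def)
qed

end
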